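(* Let $G=(V,E)$ be a (connected, locally finite) unimodular transitive graph of degree $d$. Then \[ \mathbf{P}_{p,h}\bigl(\mathscr{T}_{e}\bigr)\leq 33\cdot d\left[\frac{1-p}{p}h\right]^{1/2} \] for every $e\in E$, $p\in(0,1]$ and $h>0$.
   Context: A graph $G=(V,E)$ is transitive if for any two vertices $u,v\in V$ there is an automorphism of $G$ mapping $u$ to $v$. Let $\operatorname{Aut}(G)$ be the automorphism group of $G$, let $\operatorname{Stab}_v=\{\gamma\in\operatorname{Aut}(G):\gamma v=v\}$ and $\operatorname{Stab}_v u=\{\gamma u:\gamma\in\operatorname{Stab}_v\}$. A transitive graph $G$ is unimodular if $|\operatorname{Stab}_v u|=|\operatorname{Stab}_u v|$ for all $u,v\in V$. Bernoulli-$p$ bond percolation $\omega_p\in\{0,1\}^E$ is the random subgraph of $G$ in which each edge is retained (open, value $1$) independently with probability $p$ and otherwise deleted (closed, value $0$). Connected components of $\omega_p$ are called clusters. An edge touches a set of vertices (or a cluster) if it has at least one endpoint in it. Ghost field: independently of $\omega_p$, let $\mathcal{G}_h$ be a random subset of $E$ in which each edge of $E$ is included independently at random with probability $1-e^{-h}$. An edge is called green if it is included in $\mathcal{G}_h$. $\mathbf{P}_{p,h}$ denotes the joint law of $\omega_p$ and $\mathcal{G}_h$. For an edge $e$, $\mathscr{T}_e$ is the event that $e$ is closed in $\omega_p$ and that the endpoints of $e$ are in distinct clusters of $\omega_p$, each of which touches some green edge, and at least one of which is finite. *)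

theory Defs
  imports "HOL-Probability.Probability"
begin

text \<open>A (simple, undirected) graph is a vertex set \<open>V\<close> together with a set \<open>E\<close> of
  two-element subsets of \<open>V\<close>; the vertices in an edge are its endpoints.\<close>

definition is_graph :: "'v set \<Rightarrow> 'v set set \<Rightarrow> bool" where
  "is_graph V E \<longleftrightarrow> (\<forall>e\<in>E. e \<subseteq> V \<and> card e = 2)"

definition locally_finite_graph :: "'v set \<Rightarrow> 'v set set \<Rightarrow> bool" where
  "locally_finite_graph V E \<longleftrightarrow> (\<forall>v\<in>V. finite {e\<in>E. v \<in> e})"

definition vertex_degree :: "'v set set \<Rightarrow> 'v \<Rightarrow> nat" where
  "vertex_degree E v = card {e\<in>E. v \<in> e}"

definition component_of_vertex :: "'v set set \<Rightarrow> 'v \<Rightarrow> 'v set" where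
  "component_of_vertex F v = {u. (v, u) \<in> {(x, y). {x, y} \<in> F}\<^sup>*}"

definition connected_graph :: "'v set \<Rightarrow> 'v set set \<Rightarrow> bool" where
  "connected_graph V E \<longleftrightarrow> (\<forall>u\<in>V. \<forall>v\<in>V. v \<in> component_of_vertex E u)"

text \<open>The restriction to \<open>extensional V\<close> only fixes the junk values of an automorphism off \<open>V\<close>.\<close>

definition graph_Aut :: "'v set \<Rightarrow> 'v set set \<Rightarrow> ('v \<Rightarrow> 'v) set" where
  "graph_Aut V E = {\<gamma> \<in> extensional V. bij_betw \<gamma> V V \<and>
     (\<forall>u\<in>V. \<forall>v\<in>V. {\<gamma> u, \<gamma> v} \<in> E \<longleftrightarrow> {u, v} \<in> E)}"

definition vertex_Stab :: "'v set \<Rightarrow> 'v set set \<Rightarrow> 'v \<Rightarrow> ('v \<Rightarrow> 'v) set" where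
  "vertex_Stab V E v = {\<gamma> \<in> graph_Aut V E. \<gamma> v = v}"

definition Stab_orbit :: "'v set \<Rightarrow> 'v set set \<Rightarrow> 'v \<Rightarrow> 'v \<Rightarrow> 'v set" where
  "Stab_orbit V E v u = {\<gamma> u | \<gamma>. \<gamma> \<in> vertex_Stab V E v}"

definition transitive_graph :: "'v set \<Rightarrow> 'v set set \<Rightarrow> bool" where
  "transitive_graph V E \<longleftrightarrow> (\<forall>u\<in>V. \<forall>v\<in>V. \<exists>\<gamma>\<in>graph_Aut V E. \<gamma> u = v)"

text \<open>In a connected, locally finite graph all the orbits below are finite (a stabiliser preserves
  distances to the fixed vertex), so \<open>card\<close> is the true cardinality.\<close>

definition unimodular_graph :: "'v set \<Rightarrow> 'v set set \<Rightarrow> bool" where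
  "unimodular_graph V E \<longleftrightarrow>
     (\<forall>u\<in>V. \<forall>v\<in>V. card (Stab_orbit V E v u) = card (Stab_orbit V E u v))"

definition bond_percolation :: "'v set set \<Rightarrow> real \<Rightarrow> ('v set \<Rightarrow> bool) measure" where
  "bond_percolation E p = (\<Pi>\<^sub>M e\<in>E. measure_pmf (bernoulli_pmf p))"

text \<open>The joint law of the percolation configuration \<open>\<omega>\<close> (\<open>True\<close> = open) and the indicator
  \<open>g\<close> of the independent ghost field (\<open>True\<close> = green).\<close>

definition ghost_percolation ::
    "'v set set \<Rightarrow> real \<Rightarrow> real \<Rightarrow> (('v set \<Rightarrow> bool) \<times> ('v set \<Rightarrow> bool)) measure" where
  "ghost_percolation E p h =
     bond_percolation E p \<Otimes>\<^sub>M (\<Pi>\<^sub>M e\<in>E. measure_pmf (bernoulli_pmf (1 - exp (- h))))"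

definition cluster :: "'v set set \<Rightarrow> ('v set \<Rightarrow> bool) \<Rightarrow> 'v \<Rightarrow> 'v set" where
  "cluster E \<omega> v = component_of_vertex {e\<in>E. \<omega> e} v"

definition touches :: "'v set \<Rightarrow> 'v set \<Rightarrow> bool" where
  "touches e K \<longleftrightarrow> e \<inter> K \<noteq> {}"

text \<open>The conditions are symmetric in the two endpoints, so the choice of the labelling
  \<open>e = {x, y}\<close> is immaterial.\<close>

definition two_ghost_event ::
    "'v set set \<Rightarrow> real \<Rightarrow> real \<Rightarrow> 'v set \<Rightarrow> (('v set \<Rightarrow> bool) \<times> ('v set \<Rightarrow> bool)) set" where
  "two_ghost_event E p h e = {(\<omega>, g) \<in> space (ghost_percolation E p h).
     \<not> \<omega> e \<and>
     (\<exists>x y. e = {x, y} \<and>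
        cluster E \<omega> x \<noteq> cluster E \<omega> y \<and>
        (\<exists>f\<in>E. g f \<and> touches f (cluster E \<omega> x)) \<and>
        (\<exists>f\<in>E. g f \<and> touches f (cluster E \<omega> y)) \<and>
        (finite (cluster E \<omega> x) \<or> finite (cluster E \<omega> y)))}"

end

theory Submission
  imports Defs
begin

text \<open>
  Let \<open>N\<^sub>e\<close> be the sum, over the distinct finite clusters \<open>K\<close> containing an endpoint of \<open>e\<close>, of the
  probability \<open>\<psi>(K)\<close> that some edge touching \<open>K\<close> is green. Opening a closed edge \<open>e\<close> merges the two
  clusters at its endpoints, and by inclusion-exclusion \<open>N\<^sub>e\<close> then drops by at least the conditional
  probability of the two-ghost event. Resampling the state of \<open>e\<close> gives
  \<open>p P(T\<^sub>e) \<le> E[N\<^sub>e (p - \<omega>\<^sub>e)]\<close>. Summing over the edges at a vertex \<open>v\<close> with cluster \<open>K\<close>, the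
  mass-transport principle rewrites the right-hand side as
  \<open>2 E[\<psi>(K) / |K| (p |E(K)| - |O(K)|); |K| < \<infinity>]\<close>, with \<open>E(K)\<close> the edges touching \<open>K\<close> and \<open>O(K)\<close> the
  open ones. Here \<open>\<psi>(K) / |K| \<le> 2 d h / (1 + h |E(K)|)\<close>, and \<open>p |E(K)| - |O(K)|\<close> is the final value of
  a martingale, obtained by exploring the cluster edge by edge, whose increments have variance
  \<open>p (1 - p)\<close>. The sum over \<open>n\<close> of \<open>4 h\<^sup>2 / (1 + h n)\<^sup>2\<close> is at most \<open>4 h\<close>, so the second moment of the weighted
  fluctuation is at most \<open>4 h p (1 - p)\<close>, and the Cauchy-Schwarz inequality yields the bound with constant
  \<open>4\<close> in place of \<open>33\<close>.
\<close>

section \<open>Clusters\<close>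

lemma component_of_vertex_refl: "v \<in> component_of_vertex F v"
  by (simp add: component_of_vertex_def)

lemma component_of_vertex_step:
  "\<lbrakk>w \<in> component_of_vertex F v; {w, u} \<in> F\<rbrakk> \<Longrightarrow> u \<in> component_of_vertex F v"
  unfolding component_of_vertex_def by (auto intro: rtrancl_into_rtrancl)

lemma component_of_vertex_induct [consumes 1, case_names base step]:
  assumes "u \<in> component_of_vertex F v" "P v"
    "\<And>w u. \<lbrakk>w \<in> component_of_vertex F v; {w, u} \<in> F; P w\<rbrakk> \<Longrightarrow> P u"
  shows "P u"
proof -
  have "(v, u) \<in> {(x, y). {x, y} \<in> F}\<^sup>*"
    using assms(1) by (simp add: component_of_vertex_def)
  then show ?thesis
    by (induction rule: rtrancl_induct) (use assms in \<open>auto simp: component_of_vertex_def\<close>)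
qed

lemma component_of_vertex_sym:
  "u \<in> component_of_vertex F v \<Longrightarrow> v \<in> component_of_vertex F u"
proof -
  have "sym {(x, y). {x, y} \<in> F}"
    by (auto simp: sym_def insert_commute)
  then show "u \<in> component_of_vertex F v \<Longrightarrow> v \<in> component_of_vertex F u"
    unfolding component_of_vertex_def by (auto dest: sym_rtrancl symD)
qed

lemma component_of_vertex_eq:
  assumes "u \<in> component_of_vertex F v"
  shows "component_of_vertex F u = component_of_vertex F v"
  using assms component_of_vertex_sym[OF assms]
  unfolding component_of_vertex_def by (auto intro: rtrancl_trans)

lemma component_of_vertex_mono:
  "F \<subseteq> F' \<Longrightarrow> component_of_vertex F v \<subseteq> component_of_vertex F' v"
  unfolding component_of_vertex_def by (auto intro: set_mp[OF rtrancl_mono, rotated])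

text \<open>A path that uses the new edge lands on \<open>x\<close> or \<open>y\<close>, and both
  lie in the right-hand side, so induction along paths works whether or not the two components
  differ.\<close>

lemma component_of_vertex_insert_edge:
  "component_of_vertex (insert {x, y} F) x = component_of_vertex F x \<union> component_of_vertex F y"
    (is "?L = ?R")
proof
  show "?L \<subseteq> ?R"
  proof
    fix u assume "u \<in> ?L"
    then show "u \<in> ?R"
    proof (induction rule: component_of_vertex_induct)
      case (step w u)
      show ?case
      proof (cases "{w, u} = {x, y}")
        case True
        then show ?thesis by (auto simp: doubleton_eq_iff component_of_vertex_refl)
      next
        case False
        with step have "{w, u} \<in> F" by blast
        with step.IH show ?thesis by (auto dest: component_of_vertex_step)
      qed
    qed (simp add: component_of_vertex_refl)
  qed
  have "y \<in> ?L"
    by (rule component_of_vertex_step[OF component_of_vertex_refl]) simp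
  then have "component_of_vertex F y \<subseteq> ?L"
    using component_of_vertex_eq component_of_vertex_mono[OF subset_insertI] by metis
  then show "?R \<subseteq> ?L"
    using component_of_vertex_mono[OF subset_insertI] by (rule Un_least[rotated])
qed

lemma cluster_refl: "v \<in> cluster E \<omega> v"
  by (simp add: cluster_def component_of_vertex_refl)

lemma cluster_eq: "u \<in> cluster E \<omega> v \<Longrightarrow> cluster E \<omega> u = cluster E \<omega> v"
  by (simp add: cluster_def component_of_vertex_eq)

lemma cluster_step:
  "\<lbrakk>w \<in> cluster E \<omega> v; {w, u} \<in> E; \<omega> {w, u}\<rbrakk> \<Longrightarrow> u \<in> cluster E \<omega> v"
  unfolding cluster_def by (rule component_of_vertex_step) auto

lemma cluster_induct [consumes 1, case_names base step]:
  assumes "u \<in> cluster E \<omega> v" "P v"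
    "\<And>w u. \<lbrakk>w \<in> cluster E \<omega> v; {w, u} \<in> E; \<omega> {w, u}; P w\<rbrakk> \<Longrightarrow> P u"
  shows "P u"
  using assms(1)[unfolded cluster_def]
proof (induction rule: component_of_vertex_induct)
  case (step w u)
  then show ?case using assms(3)[of w u] by (simp add: cluster_def)
qed (fact assms(2))

text \<open>Comparing two updates of \<open>\<omega>\<close>, rather than \<open>\<omega>\<close>
  with one of them, makes the identity independent of the state of \<open>e\<close>, which is the
  form that resampling uses.\<close>

lemma cluster_open_edge:
  assumes "e \<in> E" "e = {x, y}"
  shows "cluster E (fun_upd \<omega> e True) x
    = cluster E (fun_upd \<omega> e False) x \<union> cluster E (fun_upd \<omega> e False) y"
proof -
  have "{f \<in> E. (fun_upd \<omega> e True) f} = insert {x, y} {f \<in> E. (fun_upd \<omega> e False) f}"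
    using assms by auto
  then show ?thesis
    unfolding cluster_def by (simp only: component_of_vertex_insert_edge)
qed

definition edge_boundary :: "'v set set \<Rightarrow> 'v set \<Rightarrow> 'v set set" where
  "edge_boundary E K = {e \<in> E. touches e K}"

lemma edge_boundary_Un: "edge_boundary E (K \<union> L) = edge_boundary E K \<union> edge_boundary E L"
  by (auto simp: edge_boundary_def touches_def)

text \<open>The probability that at least one edge touching \<open>K\<close> is green.\<close>

definition green_prob :: "'v set set \<Rightarrow> real \<Rightarrow> 'v set \<Rightarrow> real" where
  "green_prob E h K = 1 - exp (- h * real (card (edge_boundary E K)))"

section \<open>Finiteness and countability in a locally finite connected graph\<close>

locale lf_transitive_graph =
  fixes V :: "'v set" and E :: "'v set set" and d :: nat
  assumes graph: "is_graph V E"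
    and connected: "connected_graph V E"
    and loc_fin: "locally_finite_graph V E"
    and unimod: "unimodular_graph V E"
    and trans: "transitive_graph V E"
    and degree: "\<And>v. v \<in> V \<Longrightarrow> vertex_degree E v = d"
begin

lemma edge_subset: "e \<in> E \<Longrightarrow> e \<subseteq> V"
  and edge_card: "e \<in> E \<Longrightarrow> card e = 2"
  using graph by (auto simp: is_graph_def)

lemma edge_in_V: "{x, y} \<in> E \<Longrightarrow> x \<in> V \<and> y \<in> V"
  using edge_subset[of "{x, y}"] by simp

lemma finite_edges_at: "v \<in> V \<Longrightarrow> finite {e \<in> E. v \<in> e}"
  using loc_fin by (auto simp: locally_finite_graph_def)

lemma cluster_subset: "v \<in> V \<Longrightarrow> cluster E \<omega> v \<subseteq> V"
proof
  fix u assume "v \<in> V" "u \<in> cluster E \<omega> v"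
  from this(2) show "u \<in> V"
    by (induction rule: cluster_induct) (use \<open>v \<in> V\<close> edge_in_V in auto)
qed

lemma edge_boundary_eq_UN: "edge_boundary E K = (\<Union>v\<in>K. {e \<in> E. v \<in> e})"
  by (auto simp: edge_boundary_def touches_def)

lemma finite_edge_boundary: "finite K \<Longrightarrow> K \<subseteq> V \<Longrightarrow> finite (edge_boundary E K)"
  unfolding edge_boundary_eq_UN using finite_edges_at by auto

text \<open>Union bound over the vertices of \<open>K\<close>. The factor \<open>d\<close> of the
  final estimate comes from here.\<close>

lemma card_edge_boundary_le:
  assumes "finite K" "K \<subseteq> V"
  shows "card (edge_boundary E K) \<le> d * card K"
proof -
  have "card (edge_boundary E K) \<le> (\<Sum>v\<in>K. card {e \<in> E. v \<in> e})"
    unfolding edge_boundary_eq_UN by (rule card_UN_le[OF assms(1)])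
  also have "\<dots> = (\<Sum>v\<in>K. d)"
    using assms degree by (intro sum.cong) (auto simp: vertex_degree_def)
  finally show ?thesis by (simp add: mult.commute)
qed

lemma edgeE:
  assumes "e \<in> E"
  obtains x y where "e = {x, y}" "x \<noteq> y" "x \<in> V" "y \<in> V"
  using edge_card[OF assms] edge_subset[OF assms] by (auto simp: card_2_iff)

lemma edge_finite: "e \<in> E \<Longrightarrow> finite e"
  using edge_card by (intro card_ge_0_finite) simp

lemma finite_neighbours:
  assumes "x \<in> V"
  shows "finite {y. {x, y} \<in> E}"
proof (rule finite_subset)
  show "{y. {x, y} \<in> E} \<subseteq> \<Union>{e \<in> E. x \<in> e}" by blast
  show "finite (\<Union>{e \<in> E. x \<in> e})"
    using finite_edges_at[OF assms] edge_finite by (intro finite_Union) blast+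
qed

text \<open>By connectedness every vertex is reachable from a fixed one, and each step has finitely
  many continuations. Countability underlies the measurability proofs and the exchange of sums over
  vertices with expectations.\<close>

lemma countable_V: "countable V"
proof (cases "V = {}")
  case False
  then obtain v where v: "v \<in> V" by auto
  let ?R = "{(x, y). {x, y} \<in> E}"
  have "countable (?R\<^sup>* `` {v})"
  proof (rule countable_rtrancl)
    fix Y :: "'v set" assume Y: "countable Y"
    have "?R `` Y = (\<Union>y\<in>Y \<inter> V. {z. {y, z} \<in> E})" using edge_in_V by blast
    moreover have "countable (\<Union>y\<in>Y \<inter> V. {z. {y, z} \<in> E})"
      using Y by (intro countable_UN countable_finite[OF finite_neighbours]) auto
    ultimately show "countable (?R `` Y)" by simp
  qed simp
  moreover have "V \<subseteq> ?R\<^sup>* `` {v}"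
    using connected v unfolding connected_graph_def component_of_vertex_def by blast
  ultimately show ?thesis by (rule countable_subset[rotated])
qed simp

lemma countable_finite_subsets: "countable {A. finite A \<and> A \<subseteq> V}"
  using countable_Collect_finite_subset[OF countable_V] .

end

section \<open>Automorphisms and mass transport\<close>

text \<open>Bijections between the fibres over each value \<open>c\<close> glue to one bijection,
  because the fibres partition both sets.\<close>

lemma ex_bij_betw_fibres:
  assumes "\<And>c. \<exists>b. bij_betw b {x \<in> A. k x = c} {y \<in> B. l y = c}"
  shows "\<exists>\<phi>. bij_betw \<phi> A B \<and> (\<forall>x\<in>A. l (\<phi> x) = k x)"
proof -
  obtain b where b: "\<And>c. bij_betw (b c) {x \<in> A. k x = c} {y \<in> B. l y = c}"
    using assms by metis
  define \<phi> where "\<phi> x = b (k x) x" for x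
  have mem: "\<phi> x \<in> B" "l (\<phi> x) = k x" if "x \<in> A" for x
    using bij_betwE[OF b[of "k x"]] that by (auto simp: \<phi>_def)
  have "inj_on \<phi> A"
  proof (rule inj_onI)
    fix x y assume xy: "x \<in> A" "y \<in> A" "\<phi> x = \<phi> y"
    then have "k x = k y" using mem(2) by metis
    then show "x = y"
      using xy bij_betw_imp_inj_on[OF b[of "k x"]] by (auto simp: \<phi>_def dest: inj_onD)
  qed
  moreover have "\<phi> ` A = B"
  proof (intro equalityI subsetI)
    fix y assume "y \<in> B"
    then have "y \<in> b (l y) ` {x \<in> A. k x = l y}"
      using bij_betw_imp_surj_on[OF b[of "l y"]] by simp
    then obtain x where "x \<in> A" "k x = l y" "y = b (l y) x" by auto
    then show "y \<in> \<phi> ` A" by (intro image_eqI[of _ _ x]) (simp_all add: \<phi>_def)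
  qed (use mem in auto)
  ultimately show ?thesis using mem by (auto simp: bij_betw_def)
qed

context lf_transitive_graph
begin

abbreviation "Aut \<equiv> graph_Aut V E"

lemma Aut_D:
  assumes "\<gamma> \<in> Aut"
  shows "bij_betw \<gamma> V V"
    and "\<And>v. v \<in> V \<Longrightarrow> \<gamma> v \<in> V"
    and "\<And>u v. u \<in> V \<Longrightarrow> v \<in> V \<Longrightarrow> {\<gamma> u, \<gamma> v} \<in> E \<longleftrightarrow> {u, v} \<in> E"
    and "\<And>u v. u \<in> V \<Longrightarrow> v \<in> V \<Longrightarrow> \<gamma> u = \<gamma> v \<longleftrightarrow> u = v"
  using assms unfolding graph_Aut_def
  by (auto dest: bij_betwE bij_betw_imp_inj_on inj_onD)

lemma Aut_id: "(\<lambda>v\<in>V. v) \<in> Aut"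
  unfolding graph_Aut_def by (auto simp: bij_betw_def inj_on_def)

lemma Aut_compose:
  assumes "\<gamma> \<in> Aut" "\<delta> \<in> Aut"
  shows "compose V \<delta> \<gamma> \<in> Aut"
  using Aut_D[OF assms(1)] Aut_D[OF assms(2)]
  by (auto simp: graph_Aut_def compose_eq intro!: bij_betw_compose)

lemma Aut_inv:
  assumes "\<gamma> \<in> Aut"
  shows "(\<lambda>v\<in>V. inv_into V \<gamma> v) \<in> Aut"
    and "v \<in> V \<Longrightarrow> \<gamma> (inv_into V \<gamma> v) = v"
    and "v \<in> V \<Longrightarrow> inv_into V \<gamma> (\<gamma> v) = v"
    and "v \<in> V \<Longrightarrow> inv_into V \<gamma> v \<in> V"
proof -
  note bij = Aut_D(1)[OF assms]
  show 1: "v \<in> V \<Longrightarrow> \<gamma> (inv_into V \<gamma> v) = v" for v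
    using bij by (simp add: bij_betw_inv_into_right)
  show 2: "v \<in> V \<Longrightarrow> inv_into V \<gamma> (\<gamma> v) = v"
    using bij by (simp add: bij_betw_inv_into_left)
  show 3: "v \<in> V \<Longrightarrow> inv_into V \<gamma> v \<in> V" for v
    using bij_betw_inv_into[OF bij] by (auto dest: bij_betwE)
  have "bij_betw (\<lambda>v\<in>V. inv_into V \<gamma> v) V V"
    using bij_betw_inv_into[OF bij] by (simp cong: bij_betw_cong)
  moreover have "{inv_into V \<gamma> u, inv_into V \<gamma> v} \<in> E \<longleftrightarrow> {u, v} \<in> E"
    if "u \<in> V" "v \<in> V" for u v
    using Aut_D(3)[OF assms 3[OF that(1)] 3[OF that(2)]] 1 that by simp
  ultimately show "(\<lambda>v\<in>V. inv_into V \<gamma> v) \<in> Aut"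
    by (simp add: graph_Aut_def)
qed

lemma Stab_orbit_iff:
  "w \<in> Stab_orbit V E v u \<longleftrightarrow> (\<exists>\<gamma>\<in>Aut. \<gamma> v = v \<and> \<gamma> u = w)"
  unfolding Stab_orbit_def vertex_Stab_def by auto

lemma Stab_orbit_subset: "u \<in> V \<Longrightarrow> Stab_orbit V E v u \<subseteq> V"
  using Aut_D(2) by (auto simp: Stab_orbit_iff)

text \<open>Induction along a path from \<open>v\<close>: an automorphism fixing \<open>v\<close>
  sends a neighbour of \<open>w\<close> to a neighbour of the image of \<open>w\<close>, and there
  are finitely many of these. Equal cardinalities give a bijection only between finite sets.\<close>

lemma finite_Stab_orbit:
  assumes "v \<in> V" "u \<in> V"
  shows "finite (Stab_orbit V E v u)"
proof -
  have "u \<in> component_of_vertex E v"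
    using connected assms by (simp add: connected_graph_def)
  then have "u \<in> V \<longrightarrow> finite (Stab_orbit V E v u)"
  proof (induction rule: component_of_vertex_induct)
    case base
    have "Stab_orbit V E v v \<subseteq> {v}" by (auto simp: Stab_orbit_iff)
    then show ?case by (auto dest: finite_subset)
  next
    case (step w u)
    have w: "w \<in> V" and u: "u \<in> V" using edge_in_V[OF step(2)] by auto
    have "Stab_orbit V E v u \<subseteq> (\<Union>x\<in>Stab_orbit V E v w. {y. {x, y} \<in> E})"
    proof
      fix z assume "z \<in> Stab_orbit V E v u"
      then obtain \<gamma> where \<gamma>: "\<gamma> \<in> Aut" "\<gamma> v = v" "\<gamma> u = z" by (auto simp: Stab_orbit_iff)
      then have "\<gamma> w \<in> Stab_orbit V E v w" by (auto simp: Stab_orbit_iff)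
      moreover have "{\<gamma> w, z} \<in> E" using Aut_D(3)[OF \<gamma>(1) w u] step(2) \<gamma>(3) by simp
      ultimately show "z \<in> (\<Union>x\<in>Stab_orbit V E v w. {y. {x, y} \<in> E})" by blast
    qed
    moreover have "finite (\<Union>x\<in>Stab_orbit V E v w. {y. {x, y} \<in> E})"
      using step(3) w Stab_orbit_subset[OF w] by (intro finite_UN_I finite_neighbours) auto
    ultimately show ?case by (simp add: finite_subset)
  qed
  then show ?thesis using assms by simp
qed

text \<open>The orbit under the diagonal action; a diagonally invariant function of two vertices
  depends on this orbit only.\<close>

definition pair_orbit :: "'v \<Rightarrow> 'v \<Rightarrow> ('v \<times> 'v) set" where
  "pair_orbit u v = (\<lambda>\<gamma>. (\<gamma> u, \<gamma> v)) ` Aut"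

lemma pair_orbit_image:
  assumes "\<gamma> \<in> Aut" "u \<in> V" "v \<in> V"
  shows "pair_orbit (\<gamma> u) (\<gamma> v) = pair_orbit u v"
proof
  show "pair_orbit (\<gamma> u) (\<gamma> v) \<subseteq> pair_orbit u v"
  proof
    fix q assume "q \<in> pair_orbit (\<gamma> u) (\<gamma> v)"
    then obtain \<delta> where \<delta>: "\<delta> \<in> Aut" "q = (\<delta> (\<gamma> u), \<delta> (\<gamma> v))" by (auto simp: pair_orbit_def)
    then have "q = (compose V \<delta> \<gamma> u, compose V \<delta> \<gamma> v)"
      using assms by (simp add: compose_eq)
    then show "q \<in> pair_orbit u v"
      using Aut_compose[OF assms(1) \<delta>(1)] by (auto simp: pair_orbit_def)
  qed
  show "pair_orbit u v \<subseteq> pair_orbit (\<gamma> u) (\<gamma> v)"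
  proof
    fix q assume "q \<in> pair_orbit u v"
    then obtain \<delta> where \<delta>: "\<delta> \<in> Aut" "q = (\<delta> u, \<delta> v)" by (auto simp: pair_orbit_def)
    define \<eta> where "\<eta> = compose V \<delta> (\<lambda>v\<in>V. inv_into V \<gamma> v)"
    have "q = (\<eta> (\<gamma> u), \<eta> (\<gamma> v))"
      using assms \<delta>(2) Aut_D(2)[OF assms(1)] Aut_inv(3)[OF assms(1)]
      by (simp add: compose_eq \<eta>_def)
    then show "q \<in> pair_orbit (\<gamma> u) (\<gamma> v)"
      using Aut_compose[OF Aut_inv(1)[OF assms(1)] \<delta>(1)] by (auto simp: pair_orbit_def \<eta>_def)
  qed
qed

lemma pair_orbit_eqD:
  assumes "u \<in> V" "v \<in> V" "u' \<in> V" "v' \<in> V" "pair_orbit u v = pair_orbit u' v'"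
  shows "\<exists>\<gamma>\<in>Aut. \<gamma> u = u' \<and> \<gamma> v = v'"
proof -
  have "(u', v') \<in> pair_orbit u' v'"
    unfolding pair_orbit_def by (rule image_eqI[OF _ Aut_id]) (use assms in simp)
  then have "(u', v') \<in> pair_orbit u v" using assms(5) by simp
  then show ?thesis by (auto simp: pair_orbit_def)
qed

text \<open>An automorphism that takes \<open>(v, u)\<close> to \<open>(v, w)\<close> fixes
  \<open>v\<close>, so the fibres of \<open>pair_orbit v\<close> are the orbits of the stabiliser of
  \<open>v\<close>.\<close>

lemma fibre_fst:
  assumes "v \<in> V" "u \<in> V"
  shows "{w \<in> V. pair_orbit v w = pair_orbit v u} = Stab_orbit V E v u"
proof (intro equalityI subsetI)
  fix w assume "w \<in> {w \<in> V. pair_orbit v w = pair_orbit v u}"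
  then have "\<exists>\<gamma>\<in>Aut. \<gamma> v = v \<and> \<gamma> u = w"
    using pair_orbit_eqD[of v u v w] assms by auto
  then show "w \<in> Stab_orbit V E v u" by (simp add: Stab_orbit_iff)
next
  fix w assume "w \<in> Stab_orbit V E v u"
  then obtain \<gamma> where "\<gamma> \<in> Aut" "\<gamma> v = v" "\<gamma> u = w" by (auto simp: Stab_orbit_iff)
  then show "w \<in> {w \<in> V. pair_orbit v w = pair_orbit v u}"
    using pair_orbit_image[of \<gamma> v u] Aut_D(2)[of \<gamma> u] assms by auto
qed

text \<open>The stabiliser is again that of \<open>v\<close>, although \<open>v\<close> now stands
  in the second place.\<close>

lemma fibre_snd:
  assumes "v \<in> V" "u \<in> V"
  shows "{w \<in> V. pair_orbit w v = pair_orbit u v} = Stab_orbit V E v u"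
proof (intro equalityI subsetI)
  fix w assume "w \<in> {w \<in> V. pair_orbit w v = pair_orbit u v}"
  then have "\<exists>\<gamma>\<in>Aut. \<gamma> u = w \<and> \<gamma> v = v"
    using pair_orbit_eqD[of u v w v] assms by auto
  then show "w \<in> Stab_orbit V E v u" by (auto simp: Stab_orbit_iff)
next
  fix w assume "w \<in> Stab_orbit V E v u"
  then obtain \<gamma> where "\<gamma> \<in> Aut" "\<gamma> v = v" "\<gamma> u = w" by (auto simp: Stab_orbit_iff)
  then show "w \<in> {w \<in> V. pair_orbit w v = pair_orbit u v}"
    using pair_orbit_image[of \<gamma> u v] Aut_D(2)[of \<gamma> u] assms by auto
qed

text \<open>Conjugation by \<open>\<gamma>\<close> turns the stabiliser of \<open>v\<close> into
  that of \<open>\<gamma> v\<close>. The proof reads this off from the invariance of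
  \<open>pair_orbit\<close>, so that \<gamma> itself is the bijection.\<close>

lemma card_Stab_orbit_image:
  assumes "\<gamma> \<in> Aut" "u \<in> V" "v \<in> V"
  shows "card (Stab_orbit V E (\<gamma> v) (\<gamma> u)) = card (Stab_orbit V E v u)"
proof -
  have "bij_betw \<gamma> (Stab_orbit V E v u) (Stab_orbit V E (\<gamma> v) (\<gamma> u))"
  proof (rule bij_betw_imageI)
    show "inj_on \<gamma> (Stab_orbit V E v u)"
      using Aut_D(1)[OF assms(1)] Stab_orbit_subset[OF assms(2)]
      by (meson bij_betw_imp_inj_on inj_on_subset)
    have "w \<in> Stab_orbit V E (\<gamma> v) (\<gamma> u) \<longleftrightarrow> w \<in> \<gamma> ` Stab_orbit V E v u" if w: "w \<in> V" for w
    proof -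
      define w' where "w' = inv_into V \<gamma> w"
      have w': "w' \<in> V" "\<gamma> w' = w" using Aut_inv[OF assms(1)] w by (auto simp: w'_def)
      have "w \<in> Stab_orbit V E (\<gamma> v) (\<gamma> u) \<longleftrightarrow> pair_orbit (\<gamma> v) (\<gamma> w') = pair_orbit (\<gamma> v) (\<gamma> u)"
        using fibre_fst[of "\<gamma> v" "\<gamma> u"] Aut_D(2)[OF assms(1)] assms w w' by auto
      also have "\<dots> \<longleftrightarrow> pair_orbit v w' = pair_orbit v u"
        by (simp only: pair_orbit_image[OF assms(1,3) w'(1)] pair_orbit_image[OF assms(1,3,2)])
      also have "\<dots> \<longleftrightarrow> w' \<in> Stab_orbit V E v u"
        using fibre_fst[of v u] assms w' by auto
      also have "\<dots> \<longleftrightarrow> w \<in> \<gamma> ` Stab_orbit V E v u"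
      proof
        assume "w \<in> \<gamma> ` Stab_orbit V E v u"
        then obtain z where z: "z \<in> Stab_orbit V E v u" "w = \<gamma> z" by (rule imageE)
        then have "z = w'"
          using w' Aut_D(4)[OF assms(1), of z w'] Stab_orbit_subset[OF assms(2), of v] by auto
        then show "w' \<in> Stab_orbit V E v u" using z by simp
      next
        assume "w' \<in> Stab_orbit V E v u"
        then show "w \<in> \<gamma> ` Stab_orbit V E v u" using w'(2) by (intro image_eqI[of _ _ w']) simp_all
      qed
      finally show ?thesis .
    qed
    moreover have "Stab_orbit V E (\<gamma> v) (\<gamma> u) \<subseteq> V" "\<gamma> ` Stab_orbit V E v u \<subseteq> V"
      using Stab_orbit_subset Aut_D(2)[OF assms(1)] assms by blast+
    ultimately show "\<gamma> ` Stab_orbit V E v u = Stab_orbit V E (\<gamma> v) (\<gamma> u)" by blast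
  qed
  then show ?thesis by (simp add: bij_betw_same_card)
qed

text \<open>If \<open>\<gamma>\<close> maps \<open>u\<close> to \<open>v\<close> then \<open>(v, u)\<close> is equivalent to \<open>(\<gamma> v, v)\<close>, and by unimodularity
  the number of such \<open>u\<close> in a given orbit of pairs equals the number of such \<open>\<gamma> v\<close>.\<close>

lemma ex_orbit_transposition:
  assumes v: "v \<in> V"
  shows "\<exists>\<phi>. bij_betw \<phi> V V \<and> (\<forall>u\<in>V. pair_orbit (\<phi> u) v = pair_orbit v u)"
proof (rule ex_bij_betw_fibres)
  fix c
  show "\<exists>b. bij_betw b {u \<in> V. pair_orbit v u = c} {u \<in> V. pair_orbit u v = c}"
  proof (cases "\<exists>u\<in>V. \<exists>w\<in>V. c = pair_orbit v u \<and> c = pair_orbit w v")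
    case True
    then obtain u w where uw: "u \<in> V" "w \<in> V" "c = pair_orbit v u" "pair_orbit v u = pair_orbit w v"
      by auto
    obtain \<gamma> where \<gamma>: "\<gamma> \<in> Aut" "\<gamma> v = w" "\<gamma> u = v"
      using pair_orbit_eqD[of v u w v] uw v by auto
    \<comment> \<open>Moving \<open>(u, v)\<close> by \<gamma> gives \<open>(v, w)\<close>;
      unimodularity then exchanges the roles of \<open>u\<close> and \<open>v\<close>.\<close>
    have "card (Stab_orbit V E v w) = card (Stab_orbit V E u v)"
      using card_Stab_orbit_image[OF \<gamma>(1), of v u] \<gamma> uw v by simp
    also have "\<dots> = card (Stab_orbit V E v u)"
      using unimod uw v by (simp add: unimodular_graph_def)
    finally have "card {u \<in> V. pair_orbit v u = c} = card {u \<in> V. pair_orbit u v = c}"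
      using uw fibre_fst[OF v, of u] fibre_snd[OF v, of w] by simp
    moreover have "finite {u \<in> V. pair_orbit v u = c}" "finite {u \<in> V. pair_orbit u v = c}"
      using uw fibre_fst[OF v, of u] fibre_snd[OF v, of w] finite_Stab_orbit v by simp_all
    ultimately show ?thesis by (intro finite_same_card_bij)
  next
    \<comment> \<open>Here both fibres are empty: by transitivity a vertex in one of them can be
      moved to \<open>v\<close>, and the image of \<open>v\<close> then lies in the other
      fibre.\<close>
    case False
    have "{u \<in> V. pair_orbit v u = c} = {}"
    proof (rule ccontr)
      assume "{u \<in> V. pair_orbit v u = c} \<noteq> {}"
      then obtain u where u: "u \<in> V" "pair_orbit v u = c" by auto
      obtain \<gamma> where "\<gamma> \<in> Aut" "\<gamma> u = v" using trans u v by (auto simp: transitive_graph_def)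
      then show False
        using False u v pair_orbit_image[of \<gamma> v u] Aut_D(2)[of \<gamma> v] by metis
    qed
    moreover have "{u \<in> V. pair_orbit u v = c} = {}"
    proof (rule ccontr)
      assume "{u \<in> V. pair_orbit u v = c} \<noteq> {}"
      then obtain u where u: "u \<in> V" "pair_orbit u v = c" by auto
      obtain \<gamma> where "\<gamma> \<in> Aut" "\<gamma> u = v" using trans u v by (auto simp: transitive_graph_def)
      then show False
        using False u v pair_orbit_image[of \<gamma> u v] Aut_D(2)[of \<gamma> v] by metis
    qed
    ultimately show ?thesis by (intro exI[of _ id]) (simp only: bij_betw_id)
  qed
qed

text \<open>The bijection \<phi> matches equal terms: \<open>(\<phi> u, v)\<close> and
  \<open>(v, u)\<close> lie in one orbit, so \<open>f (\<phi> u) v = f v u\<close>. With values in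
  \<open>ennreal\<close> no summability question arises.\<close>

lemma mass_transport:
  fixes f :: "'v \<Rightarrow> 'v \<Rightarrow> ennreal"
  assumes inv: "\<And>\<gamma> u v. \<gamma> \<in> Aut \<Longrightarrow> u \<in> V \<Longrightarrow> v \<in> V \<Longrightarrow> f (\<gamma> u) (\<gamma> v) = f u v"
    and v: "v \<in> V"
  shows "(\<integral>\<^sup>+u. f u v \<partial>count_space V) = (\<integral>\<^sup>+u. f v u \<partial>count_space V)"
proof -
  obtain \<phi> where \<phi>: "bij_betw \<phi> V V" "\<And>u. u \<in> V \<Longrightarrow> pair_orbit (\<phi> u) v = pair_orbit v u"
    using ex_orbit_transposition[OF v] by auto
  have "f (\<phi> u) v = f v u" if u: "u \<in> V" for u
  proof -
    have "\<phi> u \<in> V" using \<phi>(1) u by (auto dest: bij_betwE)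
    then obtain \<gamma> where "\<gamma> \<in> Aut" "\<gamma> (\<phi> u) = v" "\<gamma> v = u"
      using pair_orbit_eqD[OF _ v v u \<phi>(2)[OF u]] by auto
    then show ?thesis using inv[of \<gamma> "\<phi> u" v] \<open>\<phi> u \<in> V\<close> v by simp
  qed
  then have "(\<integral>\<^sup>+u. f v u \<partial>count_space V) = (\<integral>\<^sup>+u. f (\<phi> u) v \<partial>count_space V)"
    by (intro nn_integral_cong) simp
  also have "\<dots> = (\<integral>\<^sup>+u. f u v \<partial>count_space V)"
    by (rule nn_integral_bij_count_space[OF \<phi>(1), of "\<lambda>u. f u v"])
  finally show ?thesis by simp
qed

section \<open>Equivariance of clusters under automorphisms\<close>

lemma Aut_image_edge:
  assumes "\<gamma> \<in> Aut"
  shows "inj_on ((`) \<gamma>) E" and "(`) \<gamma> ` E = E"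
proof -
  note \<gamma> = Aut_D[OF assms] and inv = Aut_inv[OF assms]
  show "inj_on ((`) \<gamma>) E"
    using inj_on_image_eq_iff[OF bij_betw_imp_inj_on[OF \<gamma>(1)]] edge_subset
    by (auto simp: inj_on_def)
  show "(`) \<gamma> ` E = E"
  proof (intro equalityI subsetI)
    fix f assume "f \<in> (`) \<gamma> ` E"
    then obtain e where e: "e \<in> E" "f = \<gamma> ` e" by auto
    obtain x y where "e = {x, y}" "x \<in> V" "y \<in> V" using edgeE[OF e(1)] by metis
    then show "f \<in> E" using e \<gamma>(3) by simp
  next
    fix e assume e: "e \<in> E"
    obtain x y where xy: "e = {x, y}" "x \<in> V" "y \<in> V" using edgeE[OF e(1)] by metis
    then have "{inv_into V \<gamma> x, inv_into V \<gamma> y} \<in> E"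
      using e inv \<gamma>(3)[of "inv_into V \<gamma> x" "inv_into V \<gamma> y"] by simp
    moreover have "e = \<gamma> ` {inv_into V \<gamma> x, inv_into V \<gamma> y}" using xy inv by simp
    ultimately show "e \<in> (`) \<gamma> ` E" by (rule image_eqI[rotated])
  qed
qed

text \<open>Paths are carried over by \<gamma> in one direction and by its inverse in the other.
  Restricting the pulled-back configuration to \<open>E\<close> keeps it in the extensional space of
  the product measure.\<close>

lemma cluster_Aut:
  assumes \<gamma>: "\<gamma> \<in> Aut" and u: "u \<in> V"
  shows "cluster E \<omega> (\<gamma> u) = \<gamma> ` cluster E (\<lambda>e\<in>E. \<omega> (\<gamma> ` e)) u"
    (is "_ = \<gamma> ` cluster E ?\<omega> u")
proof (intro equalityI subsetI)
  fix w assume "w \<in> cluster E \<omega> (\<gamma> u)"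
  then show "w \<in> \<gamma> ` cluster E ?\<omega> u"
  proof (induction rule: cluster_induct)
    case base
    then show ?case by (simp add: cluster_refl)
  next
    case (step w z)
    from step(4) obtain w' where w': "w' \<in> cluster E ?\<omega> u" "w = \<gamma> w'" by (rule imageE)
    have "w' \<in> V" using w' cluster_subset[OF u] by auto
    moreover have "z \<in> V" using edge_in_V[OF step(2)] by simp
    ultimately have "{w', inv_into V \<gamma> z} \<in> E" "\<gamma> ` {w', inv_into V \<gamma> z} = {w, z}"
      using Aut_D(3)[OF \<gamma>, of w' "inv_into V \<gamma> z"] Aut_inv[OF \<gamma>] step(2) w' by auto
    then have "inv_into V \<gamma> z \<in> cluster E ?\<omega> u"
      using step(3) by (intro cluster_step[OF w'(1)]) simp_all
    moreover have "z = \<gamma> (inv_into V \<gamma> z)" using Aut_inv[OF \<gamma>] \<open>z \<in> V\<close> by simp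
    ultimately show ?case by (rule image_eqI[rotated])
  qed
next
  fix w assume "w \<in> \<gamma> ` cluster E ?\<omega> u"
  then obtain w' where w': "w' \<in> cluster E ?\<omega> u" "w = \<gamma> w'" by auto
  have "\<gamma> w' \<in> cluster E \<omega> (\<gamma> u)"
    using w'(1)
  proof (induction rule: cluster_induct)
    case base
    then show ?case by (simp add: cluster_refl)
  next
    case (step w z)
    show ?case
      using step Aut_D(3)[OF \<gamma>, of w z] edge_in_V[OF step(2)]
      by (intro cluster_step[OF step(4)]) auto
  qed
  then show "w \<in> cluster E \<omega> (\<gamma> u)" using w' by simp
qed

lemma touches_Aut:
  assumes "\<gamma> \<in> Aut" "e \<subseteq> V" "K \<subseteq> V"
  shows "touches (\<gamma> ` e) (\<gamma> ` K) \<longleftrightarrow> touches e K"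
proof -
  have "\<gamma> ` e \<inter> \<gamma> ` K = \<gamma> ` (e \<inter> K)"
    using inj_on_image_Int[OF bij_betw_imp_inj_on[OF Aut_D(1)[OF assms(1)]]] assms by simp
  then show ?thesis by (simp add: touches_def)
qed

lemma edge_boundary_Aut:
  assumes "\<gamma> \<in> Aut" "K \<subseteq> V"
  shows "edge_boundary E (\<gamma> ` K) = (`) \<gamma> ` edge_boundary E K"
proof -
  have "edge_boundary E (\<gamma> ` K) = {e \<in> (`) \<gamma> ` E. touches e (\<gamma> ` K)}"
    by (simp add: edge_boundary_def Aut_image_edge[OF assms(1)])
  also have "\<dots> = (`) \<gamma> ` edge_boundary E K"
    using touches_Aut[OF assms(1) edge_subset assms(2)] by (auto simp: edge_boundary_def)
  finally show ?thesis .
qed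

lemma green_prob_Aut:
  assumes "\<gamma> \<in> Aut" "K \<subseteq> V"
  shows "green_prob E h (\<gamma> ` K) = green_prob E h K"
proof -
  have "inj_on ((`) \<gamma>) (edge_boundary E K)"
    using Aut_image_edge(1)[OF assms(1)] by (rule inj_on_subset) (simp add: edge_boundary_def)
  then show ?thesis
    by (simp add: green_prob_def edge_boundary_Aut[OF assms] card_image)
qed

end

section \<open>Bernoulli percolation\<close>

lemma prob_space_bond: "prob_space (bond_percolation E p)"
  unfolding bond_percolation_def by (intro prob_space_PiM prob_space_measure_pmf)

lemma measurable_bond_component:
  assumes "e \<in> E"
  shows "(\<lambda>\<omega>. \<omega> e) \<in> measurable (bond_percolation E p) (count_space UNIV)"
proof -
  have "(\<lambda>\<omega>. \<omega> e) \<in> measurable (bond_percolation E p) (measure_pmf (bernoulli_pmf p))"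
    unfolding bond_percolation_def using assms by (rule measurable_component_singleton)
  then show ?thesis by (simp only: measurable_cong_sets[OF refl sets_measure_pmf_count_space])
qed

lemma measurable_bond_update:
  assumes "e \<in> E"
  shows "(\<lambda>(b, \<omega>). fun_upd \<omega> e b) \<in>
    measurable (measure_pmf (bernoulli_pmf p) \<Otimes>\<^sub>M bond_percolation E p) (bond_percolation E p)"
  unfolding bond_percolation_def split_beta
  by (rule measurable_fun_upd[where J = E]) (use assms in auto)

lemma measurable_bond_update_const:
  assumes "e \<in> E"
  shows "(\<lambda>\<omega>. fun_upd \<omega> e b) \<in> measurable (bond_percolation E p) (bond_percolation E p)"
  unfolding bond_percolation_def
  by (rule measurable_fun_upd[where J = E]) (use assms in auto)

lemma space_bond: "space (bond_percolation E p) = (\<Pi>\<^sub>E e\<in>E. UNIV)"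
  by (simp add: bond_percolation_def space_PiM)

text \<open>Replacing one coordinate by an independent copy preserves the product law. It suffices
  to check cylinders, whose preimages under the update are rectangles.\<close>

lemma distr_bond_update:
  assumes e: "e \<in> E"
  shows "distr (measure_pmf (bernoulli_pmf p) \<Otimes>\<^sub>M bond_percolation E p) (bond_percolation E p)
    (\<lambda>(b, \<omega>). fun_upd \<omega> e b) = bond_percolation E p" (is "distr ?P ?B ?f = ?B")
proof (rule measure_eqI_PiM_infinite[where I = E and M = "\<lambda>_. measure_pmf (bernoulli_pmf p)"])
  interpret B: prob_space ?B by (rule prob_space_bond)
  interpret pair_prob_space "measure_pmf (bernoulli_pmf p)" ?B ..
  show "finite_measure (distr ?P ?B ?f)"
    by (rule prob_space.finite_measure[OF prob_space_distr[OF measurable_bond_update[OF e]]])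
  fix A J
  assume J: "finite J" "J \<subseteq> E" and A: "\<And>i. i \<in> J \<Longrightarrow> A i \<in> sets (measure_pmf (bernoulli_pmf p))"
  let ?b = "measure_pmf (bernoulli_pmf p)"
  let ?emb = "\<lambda>J. prod_emb E (\<lambda>_. ?b) J (Pi\<^sub>E J A)"
  \<comment> \<open>A cylinder that does not involve \<open>e\<close> puts no condition on the new
    value.\<close>
  let ?A = "if e \<in> J then A e else UNIV"
  have emb_eq: "?emb K = {\<omega> \<in> space ?B. \<forall>i\<in>K. \<omega> i \<in> A i}" if "K \<subseteq> E" for K
    unfolding prod_emb_def using that by (auto simp: space_bond PiE_def Pi_iff)
  have emb: "emeasure ?B (?emb K) = (\<Prod>i\<in>K. emeasure ?b (A i))" if "K \<subseteq> J" for K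
    unfolding bond_percolation_def
    by (rule emeasure_PiM_emb)
      (use that J A in \<open>auto intro: prob_space_measure_pmf finite_subset\<close>)
  have sets: "?emb K \<in> sets ?B" if "K \<subseteq> J" for K
    unfolding bond_percolation_def
    by (rule sets_PiM_I) (use that J in \<open>auto intro: finite_subset\<close>)
  have "?f -` ?emb J \<inter> space ?P = ?A \<times> ?emb (J - {e})"
  proof (rule set_eqI)
    fix z :: "bool \<times> ('a set \<Rightarrow> bool)"
    obtain b \<omega> where z: "z = (b, \<omega>)" by (rule prod.exhaust)
    have "fun_upd \<omega> e b \<in> space ?B" if "\<omega> \<in> space ?B"
      using that e by (simp add: space_bond PiE_def extensional_def)
    then have "z \<in> ?f -` ?emb J \<inter> space ?P
        \<longleftrightarrow> \<omega> \<in> space ?B \<and> (\<forall>i\<in>J. fun_upd \<omega> e b i \<in> A i)"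
      unfolding emb_eq[OF J(2)] by (auto simp: z space_pair_measure)
    also have "\<dots> \<longleftrightarrow> \<omega> \<in> space ?B \<and> b \<in> ?A \<and> (\<forall>i\<in>J - {e}. \<omega> i \<in> A i)"
      by (cases "e \<in> J") auto
    also have "\<dots> \<longleftrightarrow> z \<in> ?A \<times> ?emb (J - {e})"
      using emb_eq[of "J - {e}"] J by (auto simp: z)
    finally show "z \<in> ?f -` ?emb J \<inter> space ?P \<longleftrightarrow> z \<in> ?A \<times> ?emb (J - {e})" .
  qed
  then have "emeasure (distr ?P ?B ?f) (?emb J) = emeasure ?P (?A \<times> ?emb (J - {e}))"
    using sets[of J] by (simp add: emeasure_distr[OF measurable_bond_update[OF e]])
  also have "\<dots> = emeasure ?b ?A * emeasure ?B (?emb (J - {e}))"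
    by (rule B.emeasure_pair_measure_Times) (use sets[of "J - {e}"] in auto)
  also have "\<dots> = (\<Prod>i\<in>J. emeasure ?b (A i))"
  proof (cases "e \<in> J")
    case True
    then show ?thesis using J by (simp add: emb prod.remove[of J e])
  next
    case False
    then show ?thesis by (simp add: emb measure_pmf.emeasure_space_1[simplified])
  qed
  finally show "emeasure (distr ?P ?B ?f) (?emb J) = emeasure ?B (?emb J)"
    by (simp add: emb)
qed (simp_all add: bond_percolation_def)

text \<open>Conditioning on the state of \<open>e\<close>: the fresh coordinate of the preceding
  lemma is integrated out. After the update the integrands ignore \<open>\<omega> e\<close>, so both
  integrals are over the full law.\<close>

lemma nn_integral_resample:
  fixes X :: "('v set \<Rightarrow> bool) \<Rightarrow> ennreal"
  assumes e: "e \<in> E" and p: "0 \<le> p" "p \<le> 1"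
    and [measurable]: "X \<in> borel_measurable (bond_percolation E p)"
  shows "(\<integral>\<^sup>+\<omega>. X \<omega> \<partial>bond_percolation E p) =
    ennreal p * (\<integral>\<^sup>+\<omega>. X (fun_upd \<omega> e True) \<partial>bond_percolation E p) +
    ennreal (1 - p) * (\<integral>\<^sup>+\<omega>. X (fun_upd \<omega> e False) \<partial>bond_percolation E p)"
proof -
  let ?B = "bond_percolation E p"
  let ?P = "measure_pmf (bernoulli_pmf p) \<Otimes>\<^sub>M ?B"
  interpret B: prob_space ?B by (rule prob_space_bond)
  note [measurable] = measurable_bond_update[OF e]
  have "(\<integral>\<^sup>+\<omega>. X \<omega> \<partial>?B) = (\<integral>\<^sup>+\<omega>. X \<omega> \<partial>distr ?P ?B (\<lambda>(b, \<omega>). fun_upd \<omega> e b))"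
    by (simp add: distr_bond_update[OF e])
  also have "\<dots> = (\<integral>\<^sup>+z. X (case z of (b, \<omega>) \<Rightarrow> fun_upd \<omega> e b) \<partial>?P)"
    by (rule nn_integral_distr) measurable
  also have "\<dots> = (\<integral>\<^sup>+b. (\<integral>\<^sup>+\<omega>. X (fun_upd \<omega> e b) \<partial>?B) \<partial>bernoulli_pmf p)"
    by (subst B.nn_integral_fst[symmetric]) (auto simp: split_beta)
  also have "\<dots> = ennreal p * (\<integral>\<^sup>+\<omega>. X (fun_upd \<omega> e True) \<partial>?B) +
      ennreal (1 - p) * (\<integral>\<^sup>+\<omega>. X (fun_upd \<omega> e False) \<partial>?B)"
    using p by (simp add: mult.commute)
  finally show ?thesis .
qed

text \<open>All factors of the product are equal, so relabelling the coordinates preserves the law.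
  For the edge permutation of an automorphism this is the invariance of percolation.\<close>

lemma nn_integral_bond_permute:
  assumes f: "inj_on f E" "f ` E = E" and X: "X \<in> borel_measurable (bond_percolation E p)"
  shows "(\<integral>\<^sup>+\<omega>. X (\<lambda>e\<in>E. \<omega> (f e)) \<partial>bond_percolation E p) = (\<integral>\<^sup>+\<omega>. X \<omega> \<partial>bond_percolation E p)"
proof -
  let ?B = "bond_percolation E p"
  have "distr ?B ?B (\<lambda>\<omega>. \<lambda>e\<in>E. \<omega> (f e)) = ?B"
    using distr_PiM_reindex[of E "\<lambda>_. measure_pmf (bernoulli_pmf p)" f E] f
    by (auto simp: bond_percolation_def prob_space_measure_pmf)
  moreover have "(\<lambda>\<omega>. \<lambda>e\<in>E. \<omega> (f e)) \<in> measurable ?B ?B"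
    unfolding bond_percolation_def
    by (intro measurable_restrict measurable_component_singleton) (use f in auto)
  ultimately show ?thesis
    using X nn_integral_distr[of "\<lambda>\<omega>. \<lambda>e\<in>E. \<omega> (f e)" ?B ?B X] by simp
qed

lemma measurable_bond_ex:
  "finite J \<Longrightarrow> J \<subseteq> E \<Longrightarrow>
    {g \<in> space (bond_percolation E p). \<exists>f\<in>J. g f} \<in> sets (bond_percolation E p)"
  by (intro sets.sets_Collect_finite_Ex) (auto intro!: predE[OF measurable_bond_component])

text \<open>The complementary event fixes all coordinates in \<open>J\<close> to
  \<open>False\<close> and is a cylinder.\<close>

lemma prob_bond_ex:
  assumes p: "0 \<le> p" "p \<le> 1" and J: "finite J" "J \<subseteq> E"
  shows "measure (bond_percolation E p) {g \<in> space (bond_percolation E p). \<exists>f\<in>J. g f}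
    = 1 - (1 - p) ^ card J"
proof -
  let ?B = "bond_percolation E p"
  interpret product_prob_space "\<lambda>_. measure_pmf (bernoulli_pmf p)" E ..
  interpret B: prob_space ?B by (rule prob_space_bond)
  let ?N = "{g \<in> space ?B. \<forall>f\<in>J. g f \<in> {False}}"
  have "emeasure ?B ?N = (\<Prod>i\<in>J. emeasure (measure_pmf (bernoulli_pmf p)) {False})"
    unfolding bond_percolation_def by (rule emeasure_PiM_Collect) (use J in auto)
  also have "\<dots> = ennreal ((1 - p) ^ card J)"
    using p by (simp add: emeasure_pmf_single ennreal_power)
  finally have N: "measure ?B ?N = (1 - p) ^ card J"
    using p by (simp add: measure_def)
  have "{g \<in> space ?B. \<exists>f\<in>J. g f} = space ?B - ?N" by auto
  moreover have "?N \<in> sets ?B"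
  proof -
    have "?N = space ?B - {g \<in> space ?B. \<exists>f\<in>J. g f}" by auto
    then show ?thesis using measurable_bond_ex[OF J] by simp
  qed
  ultimately show ?thesis using B.prob_compl[of ?N] N by simp
qed

section \<open>Measurability of events and functions of clusters\<close>

lemma pred_countable_Bex:
  "\<lbrakk>countable I; \<And>i. i \<in> I \<Longrightarrow> Measurable.pred M (P i)\<rbrakk>
    \<Longrightarrow> Measurable.pred M (\<lambda>x. \<exists>i\<in>I. P i x)"
  unfolding pred_def by (rule sets.sets_Collect_countable_Ex')

lemma pred_countable_Ball:
  "\<lbrakk>countable I; \<And>i. i \<in> I \<Longrightarrow> Measurable.pred M (P i)\<rbrakk>
    \<Longrightarrow> Measurable.pred M (\<lambda>x. \<forall>i\<in>I. P i x)"
  unfolding pred_def by (rule sets.sets_Collect_countable_All')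

context lf_transitive_graph
begin

text \<open>Reachability in exactly \<open>n\<close> steps is measurable by induction on
  \<open>n\<close>, the next-to-last vertex ranging over the countable set \<open>V\<close>; a
  countable union over \<open>n\<close> finishes.\<close>

lemma pred_mem_cluster:
  assumes v: "v \<in> V"
  shows "Measurable.pred (bond_percolation E p) (\<lambda>\<omega>. u \<in> cluster E \<omega> v)"
proof -
  let ?B = "bond_percolation E p"
  let ?R = "\<lambda>\<omega>. {(x, y). {x, y} \<in> {e \<in> E. \<omega> e}}"
  have "Measurable.pred ?B (\<lambda>\<omega>. (v, u) \<in> ?R \<omega> ^^ n)" for n u
  proof (induction n arbitrary: u)
    case 0
    then show ?case by simp
  next
    case (Suc n)
    have "(v, u) \<in> ?R \<omega> ^^ Suc n
        \<longleftrightarrow> (\<exists>w\<in>V. (v, w) \<in> ?R \<omega> ^^ n \<and> {w, u} \<in> E \<and> \<omega> {w, u})" for \<omega>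
    proof
      assume "(v, u) \<in> ?R \<omega> ^^ Suc n"
      then obtain w where w: "(v, w) \<in> ?R \<omega> ^^ n" "(w, u) \<in> ?R \<omega>" by (rule relpow_Suc_E)
      then have "{w, u} \<in> E \<and> \<omega> {w, u}" by simp
      moreover from this have "w \<in> V" using edge_in_V[of w u] by simp
      ultimately show "\<exists>w\<in>V. (v, w) \<in> ?R \<omega> ^^ n \<and> {w, u} \<in> E \<and> \<omega> {w, u}"
        using w(1) by (intro bexI[of _ w] conjI) simp_all
    next
      assume "\<exists>w\<in>V. (v, w) \<in> ?R \<omega> ^^ n \<and> {w, u} \<in> E \<and> \<omega> {w, u}"
      then obtain w where "(v, w) \<in> ?R \<omega> ^^ n" "{w, u} \<in> E \<and> \<omega> {w, u}" by (elim bexE conjE) simp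
      then show "(v, u) \<in> ?R \<omega> ^^ Suc n" by (intro relpow_Suc_I[of v w]) simp_all
    qed
    then have eq: "(\<lambda>\<omega>. (v, u) \<in> ?R \<omega> ^^ Suc n)
        = (\<lambda>\<omega>. \<exists>w\<in>V. (v, w) \<in> ?R \<omega> ^^ n \<and> ({w, u} \<in> E \<and> \<omega> {w, u}))"
      by (rule ext)
    \<comment> \<open>Evaluation at a set outside \<open>E\<close> is not a coordinate of the
      product, so membership in \<open>E\<close> is decided first.\<close>
    have open_pred: "Measurable.pred ?B (\<lambda>\<omega>. {w, u} \<in> E \<and> \<omega> {w, u})" for w
      by (cases "{w, u} \<in> E") (simp_all add: measurable_bond_component)
    show ?case
      unfolding eq
      by (intro pred_countable_Bex[OF countable_V] pred_intros_logic(3) Suc open_pred)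
  qed
  then have "Measurable.pred ?B (\<lambda>\<omega>. \<exists>n. (v, u) \<in> ?R \<omega> ^^ n)"
    by (rule pred_intros_countable(2))
  then show ?thesis
    by (simp add: cluster_def component_of_vertex_def rtrancl_power)
qed

lemma pred_cluster_eq:
  assumes v: "v \<in> V" and A: "A \<subseteq> V"
  shows "Measurable.pred (bond_percolation E p) (\<lambda>\<omega>. cluster E \<omega> v = A)"
proof -
  have "(\<lambda>\<omega>. cluster E \<omega> v = A) = (\<lambda>\<omega>. \<forall>u\<in>V. u \<in> cluster E \<omega> v \<longleftrightarrow> u \<in> A)"
    using cluster_subset[OF v] A by (intro ext) blast
  moreover have "Measurable.pred (bond_percolation E p) (\<lambda>\<omega>. \<forall>u\<in>V. u \<in> cluster E \<omega> v \<longleftrightarrow> u \<in> A)"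
    by (intro pred_countable_Ball[OF countable_V] pred_intros_logic(6) pred_mem_cluster[OF v]) simp
  ultimately show ?thesis by simp
qed

lemma pred_finite_cluster:
  assumes v: "v \<in> V"
  shows "Measurable.pred (bond_percolation E p) (\<lambda>\<omega>. finite (cluster E \<omega> v))"
proof -
  have "(\<lambda>\<omega>. finite (cluster E \<omega> v)) = (\<lambda>\<omega>. \<exists>A\<in>{A. finite A \<and> A \<subseteq> V}. cluster E \<omega> v = A)"
    using cluster_subset[OF v] by (intro ext) auto
  moreover have "Measurable.pred (bond_percolation E p)
      (\<lambda>\<omega>. \<exists>A\<in>{A. finite A \<and> A \<subseteq> V}. cluster E \<omega> v = A)"
    by (intro pred_countable_Bex[OF countable_finite_subsets] pred_cluster_eq[OF v]) simp
  ultimately show ?thesis by simp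
qed

text \<open>A finite cluster takes countably many values, so it suffices that \<open>g A\<close> is
  measurable for each fixed \<open>A\<close>. Infinite clusters get the value 0 throughout.\<close>

lemma measurable_finite_cluster:
  fixes g :: "'v set \<Rightarrow> ('v set \<Rightarrow> bool) \<Rightarrow> real"
  assumes v: "v \<in> V"
    and g: "\<And>A. finite A \<Longrightarrow> A \<subseteq> V \<Longrightarrow> g A \<in> borel_measurable (bond_percolation E p)"
  shows "(\<lambda>\<omega>. if finite (cluster E \<omega> v) then g (cluster E \<omega> v) \<omega> else 0)
    \<in> borel_measurable (bond_percolation E p)"
proof -
  let ?B = "bond_percolation E p" and ?I = "{A. finite A \<and> A \<subseteq> V}"
  \<comment> \<open>The empty set is a dummy value for infinite clusters that keeps \<open>L\<close>
    inside a countable range; the surrounding conditional discards it afterwards.\<close>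
  define L where "L \<omega> = (if finite (cluster E \<omega> v) then cluster E \<omega> v else {})" for \<omega>
  have "L \<in> measurable ?B (count_space ?I)"
  proof (subst measurable_count_space_eq_countable[OF countable_finite_subsets], intro conjI ballI)
    show "L \<in> space ?B \<rightarrow> ?I"
      using cluster_subset[OF v] by (auto simp: L_def)
    fix A assume A: "A \<in> ?I"
    let ?P = "\<lambda>\<omega>. (finite (cluster E \<omega> v) \<longrightarrow> cluster E \<omega> v = A)
      \<and> (\<not> finite (cluster E \<omega> v) \<longrightarrow> {} = A)"
    have "A \<subseteq> V" using A by simp
    note fin = pred_finite_cluster[OF v, of p]
    have "Measurable.pred ?B (\<lambda>\<omega>. finite (cluster E \<omega> v) \<longrightarrow> cluster E \<omega> v = A)"
      by (rule pred_intros_logic(4)[OF fin pred_cluster_eq[OF v \<open>A \<subseteq> V\<close>]])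
    moreover have "Measurable.pred ?B (\<lambda>\<omega>. \<not> finite (cluster E \<omega> v) \<longrightarrow> {} = A)"
      by (rule pred_intros_logic(4)[OF pred_intros_logic(2)[OF fin]]) simp
    ultimately have "Measurable.pred ?B ?P" by (rule pred_intros_logic(3))
    moreover have "L \<omega> = A \<longleftrightarrow> ?P \<omega>" for \<omega>
      unfolding L_def by simp
    then have "L -` {A} \<inter> space ?B = {\<omega> \<in> space ?B. ?P \<omega>}"
      by (intro set_eqI) (simp only: Int_iff vimage_singleton_eq mem_Collect_eq conj_commute)
    ultimately show "L -` {A} \<inter> space ?B \<in> sets ?B" by (simp only: pred_def)
  qed
  then have "(\<lambda>\<omega>. g (L \<omega>) \<omega>) \<in> borel_measurable ?B"
    using g by (rule measurable_compose_countable'[OF _ _ countable_finite_subsets, rotated]) simp_all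
  then have "(\<lambda>\<omega>. if finite (cluster E \<omega> v) then g (L \<omega>) \<omega> else 0) \<in> borel_measurable ?B"
    by (rule measurable_If[OF _ measurable_const predE[OF pred_finite_cluster[OF v]]]) simp
  moreover have "(if finite (cluster E \<omega> v) then g (L \<omega>) \<omega> else 0)
      = (if finite (cluster E \<omega> v) then g (cluster E \<omega> v) \<omega> else 0)" for \<omega>
    by (simp only: L_def if_True split: if_split) simp
  ultimately show ?thesis by (simp only:)
qed

end

section \<open>Exploration of a cluster\<close>

text \<open>Once this is empty, with \<open>Op\<close> the open edges of \<open>R\<close>, the
  component of \<open>v\<close> in \<open>Op\<close> is the whole cluster and every edge touching it
  has been revealed.\<close>

definition frontier :: "'v set set \<Rightarrow> 'v \<Rightarrow> 'v set set \<Rightarrow> 'v set set \<Rightarrow> 'v set set" where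
  "frontier E v R Op = {e \<in> E - R. touches e (component_of_vertex Op v)}"

text \<open>The edge-by-edge exploration of the cluster of \<open>v\<close>; \<open>R\<close> is the set of revealed edges and
  \<open>Op\<close> the set of those found open.\<close>

fun explore :: "'v set set \<Rightarrow> 'v \<Rightarrow> nat \<Rightarrow> 'v set set \<Rightarrow> 'v set set \<Rightarrow> ('v set \<Rightarrow> bool)
    \<Rightarrow> 'v set set \<times> 'v set set" where
  "explore E v 0 R Op \<omega> = (R, Op)"
| "explore E v (Suc n) R Op \<omega> =
    (if frontier E v R Op = {} then (R, Op)
     else let e = (SOME e. e \<in> frontier E v R Op)
       in explore E v n (insert e R) (if \<omega> e then insert e Op else Op) \<omega>)"

declare explore.simps(2) [simp del]

lemma explore_stop: "frontier E v R Op = {} \<Longrightarrow> explore E v n R Op \<omega> = (R, Op)"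
  by (cases n) (simp_all add: explore.simps(2))

text \<open>The next edge depends on \<open>R\<close> and \<open>Op\<close> alone, hence one
  \<open>e\<close> serves all \<open>n\<close> and \<open>\<omega>\<close>. This is what permits
  conditioning on the state of \<open>e\<close>.\<close>

lemma explore_step:
  assumes "frontier E v R Op \<noteq> {}"
  obtains e where "e \<in> E" "e \<notin> R" "touches e (component_of_vertex Op v)"
    "\<And>n \<omega>. explore E v (Suc n) R Op \<omega> =
      explore E v n (insert e R) (if \<omega> e then insert e Op else Op) \<omega>"
proof
  let ?e = "SOME e. e \<in> frontier E v R Op"
  have "?e \<in> frontier E v R Op" using assms some_in_eq[of "frontier E v R Op"] by simp
  then show "?e \<in> E" "?e \<notin> R" "touches ?e (component_of_vertex Op v)"
    by (simp_all add: frontier_def)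
  show "explore E v (Suc n) R Op \<omega> =
      explore E v n (insert ?e R) (if \<omega> ?e then insert ?e Op else Op) \<omega>" for n \<omega>
    using assms by (simp add: explore.simps(2) Let_def)
qed

text \<open>Only edges outside \<open>R\<close> are ever queried.\<close>

lemma explore_update_revealed:
  "e \<in> R \<Longrightarrow> explore E v n R Op (fun_upd \<omega> e b) = explore E v n R Op \<omega>"
proof (induction n arbitrary: R Op)
  case (Suc n)
  show ?case
  proof (cases "frontier E v R Op = {}")
    case False
    then obtain e' where e': "e' \<notin> R" and step: "\<And>n \<omega>. explore E v (Suc n) R Op \<omega> =
        explore E v n (insert e' R) (if \<omega> e' then insert e' Op else Op) \<omega>"
      by (rule explore_step) simp
    have "e' \<noteq> e" using e' Suc.prems by metis
    then show ?thesis
      by (simp only: step fun_upd_other[OF \<open>e' \<noteq> e\<close>] Suc.IH[OF insertI2[OF Suc.prems]])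
  qed (simp add: explore_stop)
qed simp

text \<open>The exploration is a decision tree of depth at most \<open>n\<close> that branches on
  one coordinate at a time, so an arbitrary \<open>s\<close> is allowed.\<close>

lemma measurable_explore:
  fixes s :: "'v set set \<times> 'v set set \<Rightarrow> ennreal"
  shows "(\<lambda>\<omega>. s (explore E v n R Op \<omega>)) \<in> borel_measurable (bond_percolation E p)"
proof (induction n arbitrary: R Op)
  case (Suc n)
  show ?case
  proof (cases "frontier E v R Op = {}")
    case False
    then obtain e where e: "e \<in> E" and step: "\<And>n \<omega>. explore E v (Suc n) R Op \<omega> =
        explore E v n (insert e R) (if \<omega> e then insert e Op else Op) \<omega>"
      by (rule explore_step) simp
    have "(\<lambda>\<omega>. s (explore E v (Suc n) R Op \<omega>)) =
      (\<lambda>\<omega>. if \<omega> e then s (explore E v n (insert e R) (insert e Op) \<omega>)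
        else s (explore E v n (insert e R) Op \<omega>))"
      by (rule ext) (simp add: step)
    then show ?thesis
      by (simp only:) (rule measurable_If[OF Suc Suc predE[OF measurable_bond_component[OF e]]])
  qed (simp add: explore_stop)
qed simp

section \<open>Second moment of the weighted exploration martingale\<close>

text \<open>The square of the weight \<open>2 * h / (1 + h * m)\<close>, which up to the factor
  \<open>d\<close> bounds \<open>green_prob\<close> per vertex of a cluster with \<open>m\<close>
  touching edges.\<close>

definition rate :: "real \<Rightarrow> nat \<Rightarrow> real" where
  "rate h m = 4 * h\<^sup>2 / (1 + h * real m)\<^sup>2"

definition score :: "real \<Rightarrow> real \<Rightarrow> 'v set set \<times> 'v set set \<Rightarrow> real" where
  "score p h = (\<lambda>(R, Op). rate h (card R) * (p * real (card R) - real (card Op))\<^sup>2)"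

lemma rate_nonneg: "0 \<le> rate h m"
  by (simp add: rate_def)

text \<open>By the second inequality \<open>4 * h / (1 + h * m)\<close> dominates the sum of
  \<open>rate h k\<close> over all \<open>k > m\<close>: it pays for the next term and for what
  remains.\<close>

lemma rate_Suc_le:
  assumes "0 < h"
  shows "rate h (Suc m) \<le> rate h m"
    and "rate h (Suc m) + 4 * h / (1 + h * real (Suc m)) \<le> 4 * h / (1 + h * real m)"
proof -
  define a where "a = 1 + h * real m"
  have a: "0 < a" using assms by (simp add: a_def add_pos_nonneg)
  have b: "1 + h * real (Suc m) = a + h" by (simp add: a_def algebra_simps)
  show "rate h (Suc m) \<le> rate h m"
    unfolding rate_def b a_def[symmetric]
    using a assms by (intro divide_left_mono power_mono mult_pos_pos) auto
  \<comment> \<open>Shrinking one factor \<open>a + h\<close> to \<open>a\<close> leaves a fraction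
    that splits into a telescoping difference.\<close>
  have "4 * h\<^sup>2 / (a + h)\<^sup>2 \<le> 4 * h\<^sup>2 / (a * (a + h))"
    using a assms by (intro divide_left_mono) (auto simp: power2_eq_square intro!: mult_right_mono)
  also have "\<dots> = 4 * h / a - 4 * h / (a + h)"
    using a assms by (simp add: field_simps power2_eq_square)
  finally show "rate h (Suc m) + 4 * h / (1 + h * real (Suc m)) \<le> 4 * h / (1 + h * real m)"
    unfolding rate_def b a_def[symmetric] by simp
qed

text \<open>The martingale \<open>p |R| - |Op|\<close> has increments of variance \<open>p (1 - p)\<close>, and \<open>rate\<close> is
  decreasing with a telescoping upper bound for its sum.\<close>

lemma explore_score_bound:
  assumes p: "0 \<le> p" "p \<le> 1" and h: "0 < h" and R: "finite R" "Op \<subseteq> R"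
  shows "(\<integral>\<^sup>+\<omega>. ennreal (score p h (explore E v n R Op \<omega>)) \<partial>bond_percolation E p)
    \<le> ennreal (score p h (R, Op) + p * (1 - p) * (4 * h / (1 + h * real (card R))))"
  using R
proof (induction n arbitrary: R Op)
  case 0
  interpret prob_space "bond_percolation E p" by (rule prob_space_bond)
  show ?case
    using p h by (auto simp: emeasure_space_1 intro!: ennreal_leI mult_nonneg_nonneg divide_nonneg_nonneg)
next
  case (Suc n)
  let ?B = "bond_percolation E p"
  interpret B: prob_space ?B by (rule prob_space_bond)
  show ?case
  proof (cases "frontier E v R Op = {}")
    case True
    then show ?thesis
      using p h by (auto simp: explore_stop B.emeasure_space_1 intro!: ennreal_leI mult_nonneg_nonneg divide_nonneg_nonneg)
  next
    case False
    then obtain e where e: "e \<in> E" "e \<notin> R" and step: "\<And>n \<omega>. explore E v (Suc n) R Op \<omega> =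
        explore E v n (insert e R) (if \<omega> e then insert e Op else Op) \<omega>"
      by (rule explore_step) simp
    define m Z where "m = card R" and "Z = p * real (card R) - real (card Op)"
    have fin: "finite Op" using Suc.prems finite_subset by metis
    have eOp: "e \<notin> Op" using Suc.prems e by blast
    \<comment> \<open>Revealing an edge adds \<open>p\<close> to \<open>Z\<close> and subtracts 1
      with probability \<open>p\<close>: the mean of the square grows by \<open>p * (1 - p)\<close>.
      Here \<open>q\<close> is the allowance for later steps.\<close>
    have variance: "p * (r * (Z + p - 1)\<^sup>2 + p * (1 - p) * q) + (1 - p) * (r * (Z + p)\<^sup>2 + p * (1 - p) * q)
        = r * Z\<^sup>2 + p * (1 - p) * (r + q)" for r q :: real
      by (simp add: power2_eq_square algebra_simps)
    let ?c = "p * (1 - p) * (4 * h / (1 + h * real (Suc m)))"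
    let ?T = "rate h (Suc m) * (Z + p - 1)\<^sup>2 + ?c" and ?F = "rate h (Suc m) * (Z + p)\<^sup>2 + ?c"
    have c: "0 \<le> ?c" using p h by (intro mult_nonneg_nonneg divide_nonneg_nonneg) auto
    have cards: "card (insert e R) = Suc m" "card (insert e Op) = Suc (card Op)"
      using Suc.prems e eOp fin by (simp_all add: m_def)
    have "(\<integral>\<^sup>+\<omega>. ennreal (score p h (explore E v (Suc n) R Op \<omega>)) \<partial>?B)
      = ennreal p * (\<integral>\<^sup>+\<omega>. ennreal (score p h (explore E v n (insert e R) (insert e Op) \<omega>)) \<partial>?B)
        + ennreal (1 - p) * (\<integral>\<^sup>+\<omega>. ennreal (score p h (explore E v n (insert e R) Op \<omega>)) \<partial>?B)"
      \<comment> \<open>The first queried edge is resampled; the rest of the exploration never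
        queries it again, so the updates disappear.\<close>
      by (subst nn_integral_resample[OF e(1) p measurable_explore])
        (simp add: step explore_update_revealed)
    also have "\<dots> \<le> ennreal p * ennreal ?T + ennreal (1 - p) * ennreal ?F"
    proof (intro add_mono mult_left_mono)
      show "(\<integral>\<^sup>+\<omega>. ennreal (score p h (explore E v n (insert e R) (insert e Op) \<omega>)) \<partial>?B) \<le> ennreal ?T"
        using Suc.IH[of "insert e R" "insert e Op"] Suc.prems
        by (simp add: score_def cards Z_def m_def algebra_simps insert_mono subset_insertI2)
      show "(\<integral>\<^sup>+\<omega>. ennreal (score p h (explore E v n (insert e R) Op \<omega>)) \<partial>?B) \<le> ennreal ?F"
        using Suc.IH[of "insert e R" Op] Suc.prems
        by (simp add: score_def cards Z_def m_def algebra_simps subset_insertI2)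
    qed simp_all
    also have "\<dots> = ennreal (p * ?T + (1 - p) * ?F)"
      using p c by (simp add: ennreal_mult[symmetric] ennreal_plus[symmetric] rate_nonneg
        add_nonneg_nonneg mult_nonneg_nonneg del: ennreal_plus)
    also have "p * ?T + (1 - p) * ?F
        = rate h (Suc m) * Z\<^sup>2 + p * (1 - p) * (rate h (Suc m) + 4 * h / (1 + h * real (Suc m)))"
      by (rule variance)
    \<comment> \<open>Monotonicity of \<open>rate\<close> handles the square and the telescoping
      inequality the variance term.\<close>
    also have "\<dots> \<le> rate h m * Z\<^sup>2 + p * (1 - p) * (4 * h / (1 + h * real m))"
      using p rate_Suc_le[OF h, of m]
      by (intro add_mono mult_right_mono mult_left_mono mult_nonneg_nonneg) auto
    also have "\<dots> = score p h (R, Op) + p * (1 - p) * (4 * h / (1 + h * real (card R)))"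
      by (simp add: score_def m_def Z_def)
    finally show ?thesis by (simp add: ennreal_leI)
  qed
qed

context lf_transitive_graph
begin

definition open_boundary :: "('v set \<Rightarrow> bool) \<Rightarrow> 'v set \<Rightarrow> 'v set set" where
  "open_boundary \<omega> K = {e \<in> edge_boundary E K. \<omega> e}"

text \<open>Each step reveals a new edge touching the cluster, until none is left. The induction
  maintains that the recorded open edges are those of \<open>R\<close> that are open in
  \<open>\<omega>\<close>.\<close>

lemma explore_finite_cluster:
  assumes v: "v \<in> V" and fin: "finite (cluster E \<omega> v)"
    and R: "R \<subseteq> edge_boundary E (cluster E \<omega> v)"
    and n: "card (edge_boundary E (cluster E \<omega> v)) \<le> n + card R"
  shows "explore E v n R {e \<in> R. \<omega> e} \<omega>
    = (edge_boundary E (cluster E \<omega> v), open_boundary \<omega> (cluster E \<omega> v))"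
  using R n
proof (induction n arbitrary: R)
  case 0
  then have "R = edge_boundary E (cluster E \<omega> v)"
    using finite_edge_boundary[OF fin cluster_subset[OF v]] by (intro card_seteq) auto
  then show ?case by (simp add: open_boundary_def)
next
  case (Suc n)
  let ?K = "cluster E \<omega> v" and ?Op = "{e \<in> R. \<omega> e}"
  let ?C = "component_of_vertex ?Op v"
  have fin': "finite (edge_boundary E ?K)"
    by (rule finite_edge_boundary[OF fin cluster_subset[OF v]])
  show ?case
  proof (cases "frontier E v R ?Op = {}")
    \<comment> \<open>With an empty frontier every open edge at the known component is already
      recorded, so this component absorbs the whole cluster.\<close>
    case True
    have "u \<in> ?C" if "u \<in> ?K" for u
      using that
    proof (induction rule: cluster_induct)
      case (step w u)
      have "touches {w, u} ?C" using step(4) by (auto simp: touches_def)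
      then have "{w, u} \<in> ?Op" using True step(2,3) by (auto simp: frontier_def)
      then show ?case by (rule component_of_vertex_step[OF step(4)])
    qed (rule component_of_vertex_refl)
    then have "touches e ?C" if "touches e ?K" for e
      using that by (auto simp: touches_def)
    then have "edge_boundary E ?K \<subseteq> R"
      using True by (auto simp: frontier_def edge_boundary_def)
    then have "R = edge_boundary E ?K" using Suc.prems by simp
    with True show ?thesis by (simp add: explore_stop open_boundary_def)
  next
    case False
    then obtain e where e: "e \<in> E" "e \<notin> R" "touches e ?C" and step: "\<And>n \<omega>'. explore E v (Suc n) R ?Op \<omega>' =
        explore E v n (insert e R) (if \<omega>' e then insert e ?Op else ?Op) \<omega>'"
      by (rule explore_step) simp
    have "?C \<subseteq> ?K"
      unfolding cluster_def
      by (rule component_of_vertex_mono) (use Suc.prems in \<open>auto simp: edge_boundary_def\<close>)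
    then have "e \<in> edge_boundary E ?K" using e by (auto simp: edge_boundary_def touches_def)
    moreover have "card (insert e R) = Suc (card R)"
      using e(2) finite_subset[OF Suc.prems(1) fin'] by simp
    ultimately have "explore E v n (insert e R) {f \<in> insert e R. \<omega> f} \<omega>
        = (edge_boundary E ?K, open_boundary \<omega> ?K)"
      using Suc.prems by (intro Suc.IH) simp_all
    moreover have "(if \<omega> e then insert e ?Op else ?Op) = {f \<in> insert e R. \<omega> f}" by auto
    ultimately show ?thesis by (simp add: step)
  qed
qed

text \<open>Fatou's lemma: for a finite cluster the score of the exploration is eventually constant
  in \<open>n\<close>, and its expectation is bounded uniformly in \<open>n\<close>. Starting from
  \<open>R = {}\<close> the bound is \<open>4 * h * (p * (1 - p))\<close>.\<close>

lemma fluctuation_bound: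
  assumes p: "0 \<le> p" "p \<le> 1" and h: "0 < h" and v: "v \<in> V"
  shows "(\<integral>\<^sup>+\<omega>. (if finite (cluster E \<omega> v)
      then ennreal (score p h (edge_boundary E (cluster E \<omega> v), open_boundary \<omega> (cluster E \<omega> v)))
      else 0) \<partial>bond_percolation E p) \<le> ennreal (4 * h * (p * (1 - p)))"
    (is "(\<integral>\<^sup>+\<omega>. ?X \<omega> \<partial>?B) \<le> _")
proof -
  let ?u = "\<lambda>n \<omega>. ennreal (score p h (explore E v n {} {} \<omega>))"
  have "?X \<omega> \<le> liminf (\<lambda>n. ?u n \<omega>)" for \<omega>
  proof (cases "finite (cluster E \<omega> v)")
    case True
    have "?u n \<omega> = ?X \<omega>" if "card (edge_boundary E (cluster E \<omega> v)) \<le> n" for n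
      using explore_finite_cluster[OF v True, of "{}" n] that True by simp
    then have "eventually (\<lambda>n. ?X \<omega> \<le> ?u n \<omega>) sequentially"
      by (intro eventually_sequentiallyI eq_refl[OF sym])
    then show ?thesis by (rule Liminf_bounded)
  qed simp
  then have "(\<integral>\<^sup>+\<omega>. ?X \<omega> \<partial>?B) \<le> (\<integral>\<^sup>+\<omega>. liminf (\<lambda>n. ?u n \<omega>) \<partial>?B)"
    by (intro nn_integral_mono)
  also have "\<dots> \<le> liminf (\<lambda>n. \<integral>\<^sup>+\<omega>. ?u n \<omega> \<partial>?B)"
    by (rule nn_integral_liminf) (rule measurable_explore)
  also have "\<dots> \<le> limsup (\<lambda>n. \<integral>\<^sup>+\<omega>. ?u n \<omega> \<partial>?B)"
    by (rule Liminf_le_Limsup) simp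
  also have "\<dots> \<le> ennreal (4 * h * (p * (1 - p)))"
  proof (rule Limsup_bounded, rule always_eventually, rule allI)
    fix n
    show "(\<integral>\<^sup>+\<omega>. ?u n \<omega> \<partial>?B) \<le> ennreal (4 * h * (p * (1 - p)))"
      using explore_score_bound[OF p h, where R = "{}" and Op = "{}" and E = E and v = v and n = n] by (simp add: score_def mult_ac)
  qed
  finally show ?thesis .
qed

end

section \<open>Transport of green probability\<close>

lemma green_prob_nonneg: "0 < h \<Longrightarrow> 0 \<le> green_prob E h K"
  by (simp add: green_prob_def)

lemma green_prob_le_1: "green_prob E h K \<le> 1"
  by (simp add: green_prob_def)

context lf_transitive_graph
begin

text \<open>A finite cluster spreads \<open>green_prob\<close> uniformly over its vertices \<open>u\<close>, and each of them sends
  the \<open>c\<close>-weighted mass of every edge touching the cluster to both endpoints \<open>v\<close> of that edge.\<close>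

definition flow :: "real \<Rightarrow> (bool \<Rightarrow> real) \<Rightarrow> 'v \<Rightarrow> 'v \<Rightarrow> ('v set \<Rightarrow> bool) \<Rightarrow> real" where
  "flow h c u v \<omega> = (if finite (cluster E \<omega> u)
     then green_prob E h (cluster E \<omega> u) / real (card (cluster E \<omega> u))
       * (\<Sum>e\<in>{e \<in> edge_boundary E (cluster E \<omega> u). v \<in> e}. c (\<omega> e))
     else 0)"

text \<open>The total of \<open>flow\<close> out of \<open>u\<close>; the factor 2 counts the two
  endpoints of each edge.\<close>

definition outflow :: "real \<Rightarrow> (bool \<Rightarrow> real) \<Rightarrow> 'v \<Rightarrow> ('v set \<Rightarrow> bool) \<Rightarrow> real" where
  "outflow h c u \<omega> = (if finite (cluster E \<omega> u)
     then green_prob E h (cluster E \<omega> u) / real (card (cluster E \<omega> u))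
       * (2 * (\<Sum>e\<in>edge_boundary E (cluster E \<omega> u). c (\<omega> e)))
     else 0)"

text \<open>As a set of clusters, not a family over the endpoints, it counts a cluster containing
  both endpoints once.\<close>

definition finite_clusters_at :: "('v set \<Rightarrow> bool) \<Rightarrow> 'v set \<Rightarrow> 'v set set" where
  "finite_clusters_at \<omega> e = {K \<in> cluster E \<omega> ` e. finite K}"

text \<open>The quantity \<open>N\<^sub>e\<close> of the overview.\<close>

definition edge_mass :: "real \<Rightarrow> ('v set \<Rightarrow> bool) \<Rightarrow> 'v set \<Rightarrow> real" where
  "edge_mass h \<omega> e = (\<Sum>K\<in>finite_clusters_at \<omega> e. green_prob E h K)"

lemma measurable_edge_weight:
  fixes c :: "bool \<Rightarrow> real"
  assumes "e \<in> E"
  shows "(\<lambda>\<omega>. c (\<omega> e)) \<in> borel_measurable (bond_percolation E p)"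
  by (rule measurable_compose[OF measurable_bond_component[OF assms]]) simp

lemma measurable_flow:
  assumes u: "u \<in> V"
  shows "flow h c u v \<in> borel_measurable (bond_percolation E p)"
proof -
  have "(\<lambda>\<omega>. if finite (cluster E \<omega> u)
      then (\<lambda>A \<omega>. green_prob E h A / real (card A) * (\<Sum>e\<in>{e \<in> edge_boundary E A. v \<in> e}. c (\<omega> e)))
        (cluster E \<omega> u) \<omega> else 0) \<in> borel_measurable (bond_percolation E p)"
    by (rule measurable_finite_cluster[OF u])
      (intro borel_measurable_times borel_measurable_const borel_measurable_sum
        measurable_edge_weight, simp add: edge_boundary_def)
  then show ?thesis by (simp add: flow_def[abs_def])
qed

lemma measurable_outflow:
  assumes u: "u \<in> V"
  shows "outflow h c u \<in> borel_measurable (bond_percolation E p)"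
proof -
  have "(\<lambda>\<omega>. if finite (cluster E \<omega> u)
      then (\<lambda>A \<omega>. green_prob E h A / real (card A) * (2 * (\<Sum>e\<in>edge_boundary E A. c (\<omega> e))))
        (cluster E \<omega> u) \<omega> else 0) \<in> borel_measurable (bond_percolation E p)"
    by (rule measurable_finite_cluster[OF u])
      (intro borel_measurable_times borel_measurable_const borel_measurable_sum
        measurable_edge_weight, simp add: edge_boundary_def)
  then show ?thesis by (simp add: outflow_def[abs_def])
qed

text \<open>Invariance holds pointwise up to relabelling the configuration, and hence exactly in
  expectation.\<close>

lemma flow_Aut:
  assumes \<gamma>: "\<gamma> \<in> Aut" and u: "u \<in> V" and v: "v \<in> V"
  shows "flow h c (\<gamma> u) (\<gamma> v) \<omega> = flow h c u v (\<lambda>e\<in>E. \<omega> (\<gamma> ` e))"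
proof -
  let ?\<omega> = "\<lambda>e\<in>E. \<omega> (\<gamma> ` e)"
  let ?K = "cluster E ?\<omega> u"
  note K = cluster_subset[OF u, of ?\<omega>]
  have inj: "inj_on \<gamma> V" by (rule bij_betw_imp_inj_on[OF Aut_D(1)[OF \<gamma>]])
  have injK: "inj_on \<gamma> ?K" by (rule inj_on_subset[OF inj K])
  have mem: "\<gamma> v \<in> \<gamma> ` e \<longleftrightarrow> v \<in> e" if "e \<in> E" for e
    using inj_on_image_mem_iff[OF inj v edge_subset[OF that]] .
  have "{e \<in> edge_boundary E (\<gamma> ` ?K). \<gamma> v \<in> e} = (`) \<gamma> ` {e \<in> edge_boundary E ?K. v \<in> e}"
    unfolding edge_boundary_Aut[OF \<gamma> K] using mem by (auto simp: edge_boundary_def)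
  moreover have "inj_on ((`) \<gamma>) {e \<in> edge_boundary E ?K. v \<in> e}"
    by (rule inj_on_subset[OF Aut_image_edge(1)[OF \<gamma>]]) (auto simp: edge_boundary_def)
  ultimately have "(\<Sum>e\<in>{e \<in> edge_boundary E (\<gamma> ` ?K). \<gamma> v \<in> e}. c (\<omega> e))
      = (\<Sum>e\<in>{e \<in> edge_boundary E ?K. v \<in> e}. c (\<omega> (\<gamma> ` e)))"
    by (simp add: sum.reindex)
  also have "\<dots> = (\<Sum>e\<in>{e \<in> edge_boundary E ?K. v \<in> e}. c (?\<omega> e))"
    by (rule sum.cong) (simp_all add: edge_boundary_def)
  finally show ?thesis
    unfolding flow_def cluster_Aut[OF \<gamma> u] green_prob_Aut[OF \<gamma> K] card_image[OF injK]
      finite_image_iff[OF injK] by simp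
qed

text \<open>Double counting of pairs of an edge touching the cluster and an endpoint of it. Only the
  finitely many endpoints receive mass, which turns the integral into a finite sum.\<close>

lemma sum_flow_out:
  assumes u: "u \<in> V" and c: "\<And>b. 0 \<le> c b" and h: "0 < h"
  shows "(\<integral>\<^sup>+v. ennreal (flow h c u v \<omega>) \<partial>count_space V) = ennreal (outflow h c u \<omega>)"
proof (cases "finite (cluster E \<omega> u)")
  case True
  let ?K = "cluster E \<omega> u"
  let ?F = "edge_boundary E ?K"
  let ?a = "green_prob E h ?K / real (card ?K)"
  have finF: "finite ?F" by (rule finite_edge_boundary[OF True cluster_subset[OF u]])
  have F: "e \<in> E" if "e \<in> ?F" for e using that by (simp add: edge_boundary_def)
  have finU: "finite (\<Union>?F)" using finF F edge_finite by (intro finite_Union) metis+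
  have UV: "\<Union>?F \<subseteq> V" using F edge_subset by (intro Union_least) metis
  have zero: "flow h c u v \<omega> = 0" if "v \<notin> \<Union>?F" for v
  proof -
    have "{e \<in> ?F. v \<in> e} = {}" using that by auto
    then show ?thesis by (simp only: flow_def sum.empty mult_zero_right if_cancel)
  qed
  have "(\<integral>\<^sup>+v. ennreal (flow h c u v \<omega>) \<partial>count_space V) = (\<Sum>v\<in>\<Union>?F. ennreal (flow h c u v \<omega>))"
    by (rule nn_integral_count_space'[OF finU _ UV]) (simp only: zero ennreal_0 not_False_eq_True)
  also have "\<dots> = ennreal (\<Sum>v\<in>\<Union>?F. flow h c u v \<omega>)"
    by (rule sum_ennreal)
      (auto simp: flow_def green_prob_nonneg[OF h] c intro!: mult_nonneg_nonneg divide_nonneg_nonneg sum_nonneg)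
  also have "(\<Sum>v\<in>\<Union>?F. flow h c u v \<omega>) = ?a * (\<Sum>v\<in>\<Union>?F. \<Sum>e\<in>{e \<in> ?F. v \<in> e}. c (\<omega> e))"
    using True by (simp add: flow_def sum_distrib_left)
  also have "(\<Sum>v\<in>\<Union>?F. \<Sum>e\<in>{e \<in> ?F. v \<in> e}. c (\<omega> e)) = (\<Sum>e\<in>?F. \<Sum>v\<in>{v \<in> \<Union>?F. v \<in> e}. c (\<omega> e))"
    by (rule sum.swap_restrict[OF finU finF])
  also have "\<dots> = (\<Sum>e\<in>?F. 2 * c (\<omega> e))"
  proof (rule sum.cong[OF refl])
    fix e assume e: "e \<in> ?F"
    have "{v \<in> \<Union>?F. v \<in> e} = e" using e by auto
    then show "(\<Sum>v\<in>{v \<in> \<Union>?F. v \<in> e}. c (\<omega> e)) = 2 * c (\<omega> e)"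
      using edge_card[OF F[OF e]] by simp
  qed
  finally show ?thesis using True by (simp add: outflow_def sum_distrib_left)
qed (simp add: flow_def outflow_def)

text \<open>Each finite cluster \<open>K\<close> at \<open>e\<close> is seen from its
  \<open>card K\<close> vertices, each of which contributes a share \<open>1 / card K\<close> of its
  \<open>green_prob\<close>.\<close>

lemma sum_edge_mass:
  assumes e: "e \<in> E" and c: "0 \<le> c" and h: "0 < h"
  shows "(\<integral>\<^sup>+u. ennreal (if finite (cluster E \<omega> u) \<and> touches e (cluster E \<omega> u)
      then green_prob E h (cluster E \<omega> u) / real (card (cluster E \<omega> u)) * c else 0) \<partial>count_space V)
    = ennreal (edge_mass h \<omega> e * c)" (is "(\<integral>\<^sup>+u. ennreal (?f u) \<partial>_) = _")
proof -
  let ?C = "finite_clusters_at \<omega> e"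
  have eV: "e \<subseteq> V" by (rule edge_subset[OF e])
  have finC: "finite ?C" using edge_finite[OF e] by (simp add: finite_clusters_at_def)
  have finK: "finite K" if "K \<in> ?C" for K using that by (simp add: finite_clusters_at_def)
  have finU: "finite (\<Union>?C)" using finC finK by (rule finite_Union)
  have clus: "cluster E \<omega> u = K" if "K \<in> ?C" "u \<in> K" for K u
    using that cluster_eq[of u E \<omega>] by (auto simp: finite_clusters_at_def)
  have UV: "\<Union>?C \<subseteq> V"
    using cluster_subset eV by (intro Union_least) (auto simp: finite_clusters_at_def)
  have touch: "touches e K" if "K \<in> ?C" for K
    using that cluster_refl by (fastforce simp: finite_clusters_at_def touches_def)
  have zero: "?f u = 0" if "u \<notin> \<Union>?C" for u
  proof -
    have "\<not> (finite (cluster E \<omega> u) \<and> touches e (cluster E \<omega> u))"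
    proof
      assume *: "finite (cluster E \<omega> u) \<and> touches e (cluster E \<omega> u)"
      then obtain x where x: "x \<in> e" "x \<in> cluster E \<omega> u" by (auto simp: touches_def)
      then have "cluster E \<omega> u \<in> ?C"
        using * cluster_eq[OF x(2)] by (auto simp: finite_clusters_at_def)
      then show False using that cluster_refl[of u E \<omega>] by auto
    qed
    then show ?thesis by (rule if_not_P)
  qed
  have nonneg: "0 \<le> ?f u" for u
    by (split if_split, intro conjI impI mult_nonneg_nonneg divide_nonneg_nonneg
        green_prob_nonneg[OF h] c of_nat_0_le_iff order_refl)
  have "(\<integral>\<^sup>+u. ennreal (?f u) \<partial>count_space V) = (\<Sum>u\<in>\<Union>?C. ennreal (?f u))"
    by (rule nn_integral_count_space'[OF finU _ UV]) (simp only: zero ennreal_0 not_False_eq_True)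
  also have "\<dots> = ennreal (\<Sum>u\<in>\<Union>?C. ?f u)" by (rule sum_ennreal[OF nonneg])
  also have "(\<Sum>u\<in>\<Union>?C. ?f u) = (\<Sum>K\<in>?C. \<Sum>u\<in>K. ?f u)"
  proof (subst sum.Union_disjoint)
    show "\<forall>A\<in>?C. finite A" using finK by simp
    show "\<forall>A\<in>?C. \<forall>B\<in>?C. A \<noteq> B \<longrightarrow> A \<inter> B = {}" using clus by (metis disjoint_iff)
  qed simp
  also have "\<dots> = (\<Sum>K\<in>?C. green_prob E h K * c)"
  proof (rule sum.cong[OF refl])
    fix K assume K: "K \<in> ?C"
    have "(\<Sum>u\<in>K. ?f u) = (\<Sum>u\<in>K. green_prob E h K / real (card K) * c)"
      by (rule sum.cong[OF refl]) (simp only: clus[OF K] finK[OF K] touch[OF K] simp_thms if_True)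
    also have "\<dots> = green_prob E h K * c"
      using K finK[OF K] cluster_refl by (force simp: finite_clusters_at_def card_gt_0_iff)
    finally show "(\<Sum>u\<in>K. ?f u) = green_prob E h K * c" .
  qed
  finally show ?thesis by (simp add: edge_mass_def sum_distrib_right)
qed

text \<open>The mass arriving at \<open>v\<close> is regrouped by the edge at \<open>v\<close> along
  which it was sent.\<close>

lemma sum_flow_in:
  assumes v: "v \<in> V" and c: "\<And>b. 0 \<le> c b" and h: "0 < h"
  shows "(\<integral>\<^sup>+u. ennreal (flow h c u v \<omega>) \<partial>count_space V)
    = (\<Sum>e\<in>{e \<in> E. v \<in> e}. ennreal (edge_mass h \<omega> e * c (\<omega> e)))"
proof -
  let ?F = "{e \<in> E. v \<in> e}"
  let ?f = "\<lambda>e u. if finite (cluster E \<omega> u) \<and> touches e (cluster E \<omega> u)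
      then green_prob E h (cluster E \<omega> u) / real (card (cluster E \<omega> u)) * c (\<omega> e) else 0"
  have nonneg: "0 \<le> ?f e u" for e u
    by (split if_split, intro conjI impI mult_nonneg_nonneg divide_nonneg_nonneg
        green_prob_nonneg[OF h] c of_nat_0_le_iff order_refl)
  have "flow h c u v \<omega> = (\<Sum>e\<in>?F. ?f e u)" for u
  proof (cases "finite (cluster E \<omega> u)")
    case True
    let ?K = "cluster E \<omega> u"
    let ?a = "green_prob E h ?K / real (card ?K)"
    have eq: "{e \<in> edge_boundary E ?K. v \<in> e} = {e \<in> ?F. touches e ?K}"
      by (auto simp: edge_boundary_def)
    have "flow h c u v \<omega> = ?a * (\<Sum>e\<in>{e \<in> ?F. touches e ?K}. c (\<omega> e))"
      unfolding flow_def eq using True by (rule if_P)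
    also have "\<dots> = (\<Sum>e\<in>{e \<in> ?F. touches e ?K}. ?a * c (\<omega> e))"
      by (rule sum_distrib_left)
    also have "\<dots> = (\<Sum>e\<in>?F. if touches e ?K then ?a * c (\<omega> e) else 0)"
      by (rule sum.inter_filter[OF finite_edges_at[OF v]])
    finally show ?thesis using True by (simp only: simp_thms)
  qed (simp add: flow_def)
  then have "(\<integral>\<^sup>+u. ennreal (flow h c u v \<omega>) \<partial>count_space V)
      = (\<integral>\<^sup>+u. (\<Sum>e\<in>?F. ennreal (?f e u)) \<partial>count_space V)"
    by (simp only: sum_ennreal[OF nonneg])
  also have "\<dots> = (\<Sum>e\<in>?F. \<integral>\<^sup>+u. ennreal (?f e u) \<partial>count_space V)"
    by (rule nn_integral_sum) simp
  also have "\<dots> = (\<Sum>e\<in>?F. ennreal (edge_mass h \<omega> e * c (\<omega> e)))"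
    by (rule sum.cong[OF refl], rule sum_edge_mass[OF _ c h]) simp
  finally show ?thesis .
qed

text \<open>The value 0 for infinite sets mirrors their omission from
  \<open>edge_mass\<close>.\<close>

definition finite_green_prob :: "real \<Rightarrow> 'v set \<Rightarrow> real" where
  "finite_green_prob h K = (if finite K then green_prob E h K else 0)"

lemma edge_mass_doubleton:
  "edge_mass h \<omega> {x, y} = (if y \<in> cluster E \<omega> x then finite_green_prob h (cluster E \<omega> x)
    else finite_green_prob h (cluster E \<omega> x) + finite_green_prob h (cluster E \<omega> y))"
proof (cases "y \<in> cluster E \<omega> x")
  case True
  then have "finite_clusters_at \<omega> {x, y} = (if finite (cluster E \<omega> x) then {cluster E \<omega> x} else {})"
    using cluster_eq[OF True] by (auto simp: finite_clusters_at_def)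
  then show ?thesis using True by (simp add: edge_mass_def finite_green_prob_def)
next
  case False
  then have "cluster E \<omega> x \<noteq> cluster E \<omega> y" using cluster_refl by metis
  moreover have "finite_clusters_at \<omega> {x, y} = (if finite (cluster E \<omega> x) then {cluster E \<omega> x} else {})
      \<union> (if finite (cluster E \<omega> y) then {cluster E \<omega> y} else {})"
    by (auto simp: finite_clusters_at_def)
  ultimately show ?thesis using False by (simp add: edge_mass_def finite_green_prob_def)
qed

lemma measurable_edge_mass:
  assumes e: "e \<in> E" and h: "0 < h"
  shows "(\<lambda>\<omega>. edge_mass h \<omega> e) \<in> borel_measurable (bond_percolation E p)"
proof -
  let ?B = "bond_percolation E p"
  obtain x y where xy: "e = {x, y}" "x \<in> V" "y \<in> V" using edgeE[OF e] by metis
  have g: "(\<lambda>\<omega>. finite_green_prob h (cluster E \<omega> v)) \<in> borel_measurable ?B" if "v \<in> V" for v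
    unfolding finite_green_prob_def
    by (rule measurable_finite_cluster[OF that, where g = "\<lambda>A _. green_prob E h A"]) simp
  show ?thesis
    unfolding xy edge_mass_doubleton
    by (rule measurable_If[OF g[OF xy(2)] borel_measurable_add[OF g[OF xy(2)] g[OF xy(3)]]
          predE[OF pred_mem_cluster[OF xy(2)]]])
qed

lemma edge_mass_bounds:
  assumes e: "e \<in> E" and h: "0 < h"
  shows "0 \<le> edge_mass h \<omega> e" and "edge_mass h \<omega> e \<le> 2"
proof -
  show "0 \<le> edge_mass h \<omega> e"
    unfolding edge_mass_def by (rule sum_nonneg) (rule green_prob_nonneg[OF h])
  have "edge_mass h \<omega> e \<le> real (card (finite_clusters_at \<omega> e)) * 1"
    unfolding edge_mass_def by (rule sum_bounded_above) (rule green_prob_le_1)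
  also have "card (finite_clusters_at \<omega> e) \<le> card (cluster E \<omega> ` e)"
    using edge_finite[OF e] by (intro card_mono) (auto simp: finite_clusters_at_def)
  also have "card (cluster E \<omega> ` e) \<le> 2"
    using card_image_le[OF edge_finite[OF e], of "cluster E \<omega>"] edge_card[OF e] by simp
  finally show "edge_mass h \<omega> e \<le> 2" by simp
qed

text \<open>Mass transport for the expected flow: the left side is what \<open>v\<close> receives,
  the right side what it sends. It is later used for the constant \<open>p\<close> and for
  \<open>of_bool\<close> separately, since their difference may be negative.\<close>

lemma transport_identity:
  assumes v: "v \<in> V" and c: "\<And>b. 0 \<le> c b" and h: "0 < h"
  shows "(\<Sum>e\<in>{e \<in> E. v \<in> e}. \<integral>\<^sup>+\<omega>. ennreal (edge_mass h \<omega> e * c (\<omega> e)) \<partial>bond_percolation E p)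
    = (\<integral>\<^sup>+\<omega>. ennreal (outflow h c v \<omega>) \<partial>bond_percolation E p)"
proof -
  let ?B = "bond_percolation E p"
  let ?f = "\<lambda>u v. \<integral>\<^sup>+\<omega>. ennreal (flow h c u v \<omega>) \<partial>?B"
  have meas: "(\<lambda>\<omega>. ennreal (flow h c u v \<omega>)) \<in> borel_measurable ?B" if "u \<in> V" for u v
    using measurable_flow[OF that] by (rule measurable_compose) simp
  have inv: "?f (\<gamma> u) (\<gamma> v) = ?f u v" if "\<gamma> \<in> Aut" "u \<in> V" "v \<in> V" for \<gamma> u v
    unfolding flow_Aut[OF that]
    by (rule nn_integral_bond_permute[OF Aut_image_edge[OF that(1)] meas[OF that(2)]])
  have "(\<Sum>e\<in>{e \<in> E. v \<in> e}. \<integral>\<^sup>+\<omega>. ennreal (edge_mass h \<omega> e * c (\<omega> e)) \<partial>?B)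
      = (\<integral>\<^sup>+\<omega>. (\<Sum>e\<in>{e \<in> E. v \<in> e}. ennreal (edge_mass h \<omega> e * c (\<omega> e))) \<partial>?B)"
    by (rule nn_integral_sum[symmetric], rule measurable_compose[OF _ measurable_ennreal],
        intro borel_measurable_times measurable_edge_mass[OF _ h] measurable_edge_weight) simp_all
  also have "\<dots> = (\<integral>\<^sup>+\<omega>. \<integral>\<^sup>+u. ennreal (flow h c u v \<omega>) \<partial>count_space V \<partial>?B)"
    by (simp only: sum_flow_in[OF v c h])
  also have "\<dots> = (\<integral>\<^sup>+u. ?f u v \<partial>count_space V)"
    by (rule nn_integral_count_space_nn_integral[OF countable_V meas])
  also have "\<dots> = (\<integral>\<^sup>+u. ?f v u \<partial>count_space V)"
    by (rule mass_transport[of ?f, OF inv v])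
  also have "\<dots> = (\<integral>\<^sup>+\<omega>. \<integral>\<^sup>+u. ennreal (flow h c v u \<omega>) \<partial>count_space V \<partial>?B)"
    by (rule nn_integral_count_space_nn_integral[OF countable_V meas[OF v], symmetric])
  also have "\<dots> = (\<integral>\<^sup>+\<omega>. ennreal (outflow h c v \<omega>) \<partial>?B)"
    by (simp only: sum_flow_out[OF v c h])
  finally show ?thesis .
qed

lemma finite_green_prob_nonneg: "0 < h \<Longrightarrow> 0 \<le> finite_green_prob h K"
  by (simp add: finite_green_prob_def green_prob_nonneg)

section \<open>The two-ghost event\<close>

definition green_event :: "real \<Rightarrow> 'v set \<Rightarrow> ('v set \<Rightarrow> bool) set" where
  "green_event q K = {g \<in> space (bond_percolation E q). \<exists>f\<in>edge_boundary E K. g f}"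

lemma edge_boundary_subset: "edge_boundary E K \<subseteq> E"
  by (simp add: edge_boundary_def)

lemma sets_green_event:
  "finite K \<Longrightarrow> K \<subseteq> V \<Longrightarrow> green_event q K \<in> sets (bond_percolation E q)"
  unfolding green_event_def by (intro measurable_bond_ex finite_edge_boundary edge_boundary_subset)

lemma prob_green_event:
  assumes "0 < h" "finite K" "K \<subseteq> V"
  shows "measure (bond_percolation E (1 - exp (- h))) (green_event (1 - exp (- h)) K) = green_prob E h K"
proof -
  have "exp (- h) ^ n = exp (- h * real n)" for n
    by (simp add: exp_of_nat_mult[symmetric] mult.commute)
  then show ?thesis
    unfolding green_event_def green_prob_def
    using prob_bond_ex[OF _ _ finite_edge_boundary[OF assms(2,3)] edge_boundary_subset, of "1 - exp (- h)"] assms(1)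
    by simp
qed

lemma prob_green_event_Int:
  assumes h: "0 < h" and K: "finite K" "K \<subseteq> V" and L: "finite L" "L \<subseteq> V"
  shows "measure (bond_percolation E (1 - exp (- h)))
      (green_event (1 - exp (- h)) K \<inter> green_event (1 - exp (- h)) L)
    = green_prob E h K + green_prob E h L - green_prob E h (K \<union> L)"
proof -
  let ?q = "1 - exp (- h)"
  let ?B = "bond_percolation E ?q"
  interpret prob_space ?B by (rule prob_space_bond)
  have "green_event ?q (K \<union> L) = green_event ?q K \<union> green_event ?q L"
    by (auto simp: green_event_def edge_boundary_Un)
  then have "green_prob E h (K \<union> L) = measure ?B (green_event ?q K \<union> green_event ?q L)"
    using prob_green_event[OF h, of "K \<union> L"] K L by simp
  also have "\<dots> = measure ?B (green_event ?q K) + measure ?B (green_event ?q L)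
      - measure ?B (green_event ?q K \<inter> green_event ?q L)"
    by (rule measure_Un3) (simp_all add: fmeasurable_eq_sets sets_green_event K L)
  finally show ?thesis by (simp add: prob_green_event[OF h K] prob_green_event[OF h L])
qed

text \<open>Opening \<open>e\<close> merges the clusters of its endpoints. By inclusion-exclusion this difference is,
  for distinct finite clusters, the probability that both touch a green edge.\<close>

definition mass_drop :: "real \<Rightarrow> ('v set \<Rightarrow> bool) \<Rightarrow> 'v set \<Rightarrow> real" where
  "mass_drop h \<omega> e = edge_mass h (fun_upd \<omega> e False) e - edge_mass h (fun_upd \<omega> e True) e"

text \<open>With \<open>e\<close> open both endpoints share the cluster \<open>K \<union> L\<close>;
  if they were already joined without \<open>e\<close>, opening it changes nothing.\<close>

lemma mass_drop_eq:
  fixes \<omega> :: "'v set \<Rightarrow> bool"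
  assumes e: "e \<in> E" "e = {x, y}"
  defines "K \<equiv> cluster E (fun_upd \<omega> e False) x" and "L \<equiv> cluster E (fun_upd \<omega> e False) y"
  shows "mass_drop h \<omega> e = (if K = L then 0
    else finite_green_prob h K + finite_green_prob h L - finite_green_prob h (K \<union> L))"
proof -
  have T: "cluster E (fun_upd \<omega> e True) x = K \<union> L"
    unfolding K_def L_def by (rule cluster_open_edge[OF e])
  have y: "y \<in> K \<union> L" unfolding L_def using cluster_refl by (rule UnI2)
  have KL: "y \<in> K \<longleftrightarrow> K = L"
    unfolding K_def L_def using cluster_eq cluster_refl by metis
  have "edge_mass h (fun_upd \<omega> e True) {x, y} = finite_green_prob h (K \<union> L)"
    unfolding edge_mass_doubleton T using y by (rule if_P)
  moreover have "edge_mass h (fun_upd \<omega> e False) {x, y}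
      = (if K = L then finite_green_prob h K else finite_green_prob h K + finite_green_prob h L)"
    unfolding edge_mass_doubleton K_def[symmetric] L_def[symmetric] KL ..
  ultimately show ?thesis unfolding mass_drop_def using e(2) by simp
qed

text \<open>For finite clusters the expression is the probability of an intersection; otherwise the
  merged cluster is infinite and its subtracted term vanishes.\<close>

lemma mass_drop_nonneg:
  assumes e: "e \<in> E" and h: "0 < h"
  shows "0 \<le> mass_drop h \<omega> e"
proof -
  obtain x y where xy: "e = {x, y}" "x \<in> V" "y \<in> V" using edgeE[OF e] by metis
  let ?K = "cluster E (fun_upd \<omega> e False) x" and ?L = "cluster E (fun_upd \<omega> e False) y"
  note sub = cluster_subset[OF xy(2), of "fun_upd \<omega> e False"] cluster_subset[OF xy(3), of "fun_upd \<omega> e False"]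
  have "0 \<le> finite_green_prob h ?K + finite_green_prob h ?L - finite_green_prob h (?K \<union> ?L)"
  proof (cases "finite ?K \<and> finite ?L")
    case True
    have "0 \<le> green_prob E h ?K + green_prob E h ?L - green_prob E h (?K \<union> ?L)"
      unfolding prob_green_event_Int[OF h conjunct1[OF True] sub(1) conjunct2[OF True] sub(2), symmetric]
      by (rule measure_nonneg)
    then show ?thesis using True by (simp add: finite_green_prob_def)
  next
    case False
    then have "finite_green_prob h (?K \<union> ?L) = 0"
      unfolding finite_green_prob_def finite_Un by (rule if_not_P)
    then show ?thesis
      using finite_green_prob_nonneg[OF h, of ?K] finite_green_prob_nonneg[OF h, of ?L] by simp
  qed
  then show ?thesis unfolding mass_drop_eq[OF e xy(1)] by simp
qed

text \<open>For a fixed configuration with \<open>e\<close> closed, two distinct finite clusters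
  give exactly the inclusion-exclusion probability. If just one is finite, its own green event
  suffices as a bound.\<close>

lemma section_two_ghost_event_bound:
  assumes e: "e \<in> E" and h: "0 < h"
  shows "measure (bond_percolation E (1 - exp (- h))) (Pair \<omega> -` two_ghost_event E p h e)
    \<le> (if \<omega> e then 0 else mass_drop h \<omega> e)"
proof (cases "\<omega> e \<or> Pair \<omega> -` two_ghost_event E p h e = {}")
  case True
  moreover have "Pair \<omega> -` two_ghost_event E p h e = {}" if "\<omega> e"
    using that by (auto simp: two_ghost_event_def)
  ultimately have "Pair \<omega> -` two_ghost_event E p h e = {}" by metis
  then show ?thesis using mass_drop_nonneg[OF e h] by simp
next
  case False
  let ?q = "1 - exp (- h)"
  let ?B = "bond_percolation E ?q"
  let ?S = "Pair \<omega> -` two_ghost_event E p h e"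
  interpret prob_space ?B by (rule prob_space_bond)
  obtain x y where xy: "e = {x, y}" "x \<in> V" "y \<in> V" using edgeE[OF e] by metis
  have \<omega>: "fun_upd \<omega> e False = \<omega>" using False by (simp add: fun_upd_idem)
  let ?K = "cluster E \<omega> x" and ?L = "cluster E \<omega> y"
  have S: "?K \<noteq> ?L \<and> (finite ?K \<or> finite ?L) \<and> g \<in> green_event ?q ?K \<inter> green_event ?q ?L"
    if g: "g \<in> ?S" for g
  proof -
    \<comment> \<open>The labelling of \<open>e\<close> witnessing the event may be opposite to the
      one fixed here; the condition is symmetric.\<close>
    let ?P = "\<lambda>x y. cluster E \<omega> x \<noteq> cluster E \<omega> y \<and>
        (\<exists>f\<in>E. g f \<and> touches f (cluster E \<omega> x)) \<and>
        (\<exists>f\<in>E. g f \<and> touches f (cluster E \<omega> y)) \<and>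
        (finite (cluster E \<omega> x) \<or> finite (cluster E \<omega> y))"
    have "g \<in> space ?B"
      using g by (simp add: two_ghost_event_def ghost_percolation_def space_pair_measure bond_percolation_def)
    obtain x' y' where "e = {x', y'}" "?P x' y'"
      using g by (auto simp: two_ghost_event_def)
    then have "?P x y"
      unfolding xy(1) doubleton_eq_iff by (elim disjE conjE) simp_all
    then show ?thesis
      using \<open>g \<in> space ?B\<close> by (auto simp: green_event_def edge_boundary_def)
  qed
  obtain g where "g \<in> ?S" using False by blast
  from S[OF this] have KL: "?K \<noteq> ?L" "finite ?K \<or> finite ?L" by simp_all
  have drop: "mass_drop h \<omega> e = finite_green_prob h ?K + finite_green_prob h ?L - finite_green_prob h (?K \<union> ?L)"
    unfolding mass_drop_eq[OF e xy(1)] \<omega> using KL(1) by (rule if_not_P)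
  note sub = cluster_subset[OF xy(2), of \<omega>] cluster_subset[OF xy(3), of \<omega>]
  have "measure ?B ?S \<le> mass_drop h \<omega> e"
  proof (cases "finite ?K \<and> finite ?L")
    case True
    have "measure ?B ?S \<le> measure ?B (green_event ?q ?K \<inter> green_event ?q ?L)"
      by (rule finite_measure_mono) (use S True sub sets_green_event in auto)
    then show ?thesis
      using True by (simp add: drop prob_green_event_Int[OF h _ sub(1) _ sub(2)] finite_green_prob_def)
  next
    case False
    \<comment> \<open>\<open>M\<close> is the finite one of the two clusters; the drop is then
      \<open>finite_green_prob h M\<close>, the other two terms being 0.\<close>
    then obtain M where M: "M = ?K \<or> M = ?L" "finite M" using KL(2) by metis
    have "M \<subseteq> V" using M(1) sub by (elim disjE) simp_all
    have "measure ?B ?S \<le> measure ?B (green_event ?q M)"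
    proof (rule finite_measure_mono)
      show "?S \<subseteq> green_event ?q M" using S M(1) by (elim disjE) auto
    qed (rule sets_green_event[OF M(2) \<open>M \<subseteq> V\<close>])
    also have "\<dots> = finite_green_prob h M"
      using M(2) by (simp add: prob_green_event[OF h M(2) \<open>M \<subseteq> V\<close>] finite_green_prob_def)
    also have "\<dots> \<le> mass_drop h \<omega> e"
    proof -
      have "finite_green_prob h (?K \<union> ?L) = 0"
        using False unfolding finite_green_prob_def finite_Un by (rule if_not_P)
      then show ?thesis
        using M(1) finite_green_prob_nonneg[OF h, of ?K] finite_green_prob_nonneg[OF h, of ?L]
        by (elim disjE) (simp_all add: drop)
    qed
    finally show ?thesis .
  qed
  then show ?thesis using False by simp
qed

end

section \<open>From expected mass drop to boundary fluctuation\<close>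

lemma integral_resample:
  fixes X :: "('v set \<Rightarrow> bool) \<Rightarrow> real"
  assumes e: "e \<in> E" and p: "0 \<le> p" "p \<le> 1"
    and X: "X \<in> borel_measurable (bond_percolation E p)" "\<And>\<omega>. 0 \<le> X \<omega>" "\<And>\<omega>. X \<omega> \<le> C"
  shows "(\<integral>\<omega>. X \<omega> \<partial>bond_percolation E p) =
    p * (\<integral>\<omega>. X (fun_upd \<omega> e True) \<partial>bond_percolation E p) +
    (1 - p) * (\<integral>\<omega>. X (fun_upd \<omega> e False) \<partial>bond_percolation E p)"
proof -
  let ?B = "bond_percolation E p"
  interpret prob_space ?B by (rule prob_space_bond)
  have int: "integrable ?B (\<lambda>\<omega>. X (f \<omega>))" if "f \<in> measurable ?B ?B" for f
    by (rule integrable_const_bound[of _ C]) (use X measurable_compose[OF that X(1)] in auto)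
  have nn: "(\<integral>\<^sup>+\<omega>. ennreal (X (f \<omega>)) \<partial>?B) = ennreal (\<integral>\<omega>. X (f \<omega>) \<partial>?B)" if "f \<in> measurable ?B ?B" for f
    by (rule nn_integral_eq_integral[OF int[OF that]]) (use X in auto)
  note upd = measurable_bond_update_const[OF e]
  have pos: "0 \<le> (\<integral>\<omega>. X (f \<omega>) \<partial>?B)" for f using X(2) by (rule integral_nonneg_AE[OF AE_I2])
  have "ennreal (\<integral>\<omega>. X \<omega> \<partial>?B) = (\<integral>\<^sup>+\<omega>. ennreal (X \<omega>) \<partial>?B)"
    using nn[OF measurable_ident] by simp
  also have "\<dots> = ennreal p * (\<integral>\<^sup>+\<omega>. ennreal (X (fun_upd \<omega> e True)) \<partial>?B) +
      ennreal (1 - p) * (\<integral>\<^sup>+\<omega>. ennreal (X (fun_upd \<omega> e False)) \<partial>?B)"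
    by (rule nn_integral_resample[OF e p]) (use X(1) in simp)
  also have "\<dots> = ennreal (p * (\<integral>\<omega>. X (fun_upd \<omega> e True) \<partial>?B) +
      (1 - p) * (\<integral>\<omega>. X (fun_upd \<omega> e False) \<partial>?B))"
    unfolding nn[OF upd]
    using p pos[of "\<lambda>\<omega>. fun_upd \<omega> e True"] pos[of "\<lambda>\<omega>. fun_upd \<omega> e False"]
    by (simp add: ennreal_mult[symmetric] ennreal_plus[symmetric] del: ennreal_plus)
  finally show ?thesis
    using p pos[of "\<lambda>\<omega>. \<omega>"] pos[of "\<lambda>\<omega>. fun_upd \<omega> e True"] pos[of "\<lambda>\<omega>. fun_upd \<omega> e False"]
    by (subst (asm) ennreal_inj) (auto intro!: add_nonneg_nonneg mult_nonneg_nonneg)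
qed

text \<open>From \<open>1 - x \<le> (1 + x) * exp (- x)\<close>, after rearranging and dividing by
  \<open>1 + x\<close>.\<close>

lemma one_minus_exp_le:
  assumes "0 \<le> (x::real)"
  shows "1 - exp (- x) \<le> 2 * x / (1 + x)"
proof -
  have "1 - x \<le> exp (- x)" using exp_ge_add_one_self[of "- x"] by simp
  also have "\<dots> \<le> (1 + x) * exp (- x)" using assms by simp
  finally show ?thesis using assms by (simp add: field_simps)
qed

context lf_transitive_graph
begin

text \<open>Its square is the score of the completed exploration.\<close>

definition deviation :: "real \<Rightarrow> real \<Rightarrow> 'v \<Rightarrow> ('v set \<Rightarrow> bool) \<Rightarrow> real" where
  "deviation p h v \<omega> = (if finite (cluster E \<omega> v)
     then 2 * h / (1 + h * real (card (edge_boundary E (cluster E \<omega> v))))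
       * \<bar>p * real (card (edge_boundary E (cluster E \<omega> v)))
           - (\<Sum>e\<in>edge_boundary E (cluster E \<omega> v). of_bool (\<omega> e))\<bar>
     else 0)"

lemma measurable_deviation:
  assumes v: "v \<in> V"
  shows "deviation p h v \<in> borel_measurable (bond_percolation E p)"
proof -
  have "(\<lambda>\<omega>. if finite (cluster E \<omega> v)
      then (\<lambda>A \<omega>. 2 * h / (1 + h * real (card (edge_boundary E A)))
        * \<bar>p * real (card (edge_boundary E A)) - (\<Sum>e\<in>edge_boundary E A. of_bool (\<omega> e))\<bar>)
        (cluster E \<omega> v) \<omega> else 0) \<in> borel_measurable (bond_percolation E p)"
    by (rule measurable_finite_cluster[OF v])
      (intro borel_measurable_times borel_measurable_const borel_measurable_sum borel_measurable_abs
        borel_measurable_diff measurable_edge_weight, simp add: edge_boundary_def)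
  then show ?thesis by (simp add: deviation_def[abs_def])
qed

lemma sum_of_bool_bounds:
  assumes "finite A"
  shows "0 \<le> (\<Sum>e\<in>A. of_bool (\<omega> e) :: real)" "(\<Sum>e\<in>A. of_bool (\<omega> e) :: real) \<le> real (card A)"
proof -
  show "0 \<le> (\<Sum>e\<in>A. of_bool (\<omega> e) :: real)" by (rule sum_nonneg) simp
  have "(\<Sum>e\<in>A. of_bool (\<omega> e) :: real) \<le> real (card A) * 1" by (rule sum_bounded_above) simp
  then show "(\<Sum>e\<in>A. of_bool (\<omega> e) :: real) \<le> real (card A)" by simp
qed

lemma deviation_bounds:
  assumes v: "v \<in> V" and p: "0 \<le> p" "p \<le> 1" and h: "0 < h"
  shows "0 \<le> deviation p h v \<omega>" and "deviation p h v \<omega> \<le> 2"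
proof -
  show "0 \<le> deviation p h v \<omega>"
    unfolding deviation_def using h
    by (auto intro!: mult_nonneg_nonneg divide_nonneg_nonneg add_nonneg_nonneg)
  show "deviation p h v \<omega> \<le> 2"
  proof (cases "finite (cluster E \<omega> v)")
    case True
    let ?F = "edge_boundary E (cluster E \<omega> v)"
    let ?s = "\<Sum>e\<in>?F. of_bool (\<omega> e) :: real"
    have "finite ?F" by (rule finite_edge_boundary[OF True cluster_subset[OF v]])
    from sum_of_bool_bounds[OF this, of \<omega>] have s: "0 \<le> ?s" "?s \<le> real (card ?F)" .
    have "p * real (card ?F) \<le> 1 * real (card ?F)" using p by (intro mult_right_mono) simp_all
    moreover have "0 \<le> p * real (card ?F)" using p by simp
    ultimately have "\<bar>p * real (card ?F) - ?s\<bar> \<le> real (card ?F)" using s by linarith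
    then have "deviation p h v \<omega> \<le> 2 * h / (1 + h * real (card ?F)) * real (card ?F)"
      unfolding deviation_def if_P[OF True] using h
      by (intro mult_left_mono divide_nonneg_nonneg add_nonneg_nonneg) simp_all
    also have "\<dots> = 2 * (h * real (card ?F) / (1 + h * real (card ?F)))" by simp
    also have "\<dots> \<le> 2 * 1"
      using h by (intro mult_left_mono) (auto simp: divide_le_eq_1 add_pos_nonneg intro!: disjI2)
    finally show ?thesis by simp
  qed (simp add: deviation_def)
qed

lemma deviation_sq:
  assumes v: "v \<in> V"
  shows "ennreal ((deviation p h v \<omega>)\<^sup>2) = (if finite (cluster E \<omega> v)
      then ennreal (score p h (edge_boundary E (cluster E \<omega> v), open_boundary \<omega> (cluster E \<omega> v)))
      else 0)"
proof (cases "finite (cluster E \<omega> v)")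
  case True
  have "finite (edge_boundary E (cluster E \<omega> v))"
    by (rule finite_edge_boundary[OF True cluster_subset[OF v]])
  then have "real (card (open_boundary \<omega> (cluster E \<omega> v)))
      = (\<Sum>e\<in>edge_boundary E (cluster E \<omega> v). of_bool (\<omega> e))"
    by (simp add: open_boundary_def sum_of_bool_eq Int_def)
  then show ?thesis
    using True by (simp add: deviation_def score_def rate_def power_mult_distrib power_divide)
qed (simp add: deviation_def)

text \<open>Cauchy-Schwarz applied to the second-moment bound
  \<open>fluctuation_bound\<close>.\<close>

lemma expectation_deviation_le:
  assumes v: "v \<in> V" and p: "0 \<le> p" "p \<le> 1" and h: "0 < h"
  shows "(\<integral>\<omega>. deviation p h v \<omega> \<partial>bond_percolation E p) \<le> 2 * sqrt (h * (p * (1 - p)))"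
proof -
  let ?B = "bond_percolation E p" and ?X = "deviation p h v"
  interpret prob_space ?B by (rule prob_space_bond)
  note bounds = deviation_bounds[OF v p h] and meas = measurable_deviation[OF v, of p h]
  have int: "integrable ?B ?X"
    by (rule integrable_const_bound[of _ 2]) (use bounds meas in auto)
  have sq: "(?X \<omega>)\<^sup>2 \<le> 4" for \<omega>
    using power_mono[OF bounds(2) bounds(1), of \<omega> 2] by simp
  have int2: "integrable ?B (\<lambda>\<omega>. (?X \<omega>)\<^sup>2)"
    by (rule integrable_const_bound[of _ 4]) (use sq meas in auto)
  have "ennreal (\<integral>\<omega>. (?X \<omega>)\<^sup>2 \<partial>?B) = (\<integral>\<^sup>+\<omega>. ennreal ((?X \<omega>)\<^sup>2) \<partial>?B)"
    by (rule nn_integral_eq_integral[symmetric, OF int2]) simp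
  also have "\<dots> \<le> ennreal (4 * h * (p * (1 - p)))"
    unfolding deviation_sq[OF v] by (rule fluctuation_bound[OF p h v])
  finally have "(\<integral>\<omega>. (?X \<omega>)\<^sup>2 \<partial>?B) \<le> 4 * h * (p * (1 - p))"
    using p h by (subst (asm) ennreal_le_iff) simp_all
  \<comment> \<open>The Cauchy-Schwarz inequality enters as nonnegativity of the variance.\<close>
  moreover have "0 \<le> (\<integral>\<omega>. (?X \<omega>)\<^sup>2 \<partial>?B) - (\<integral>\<omega>. ?X \<omega> \<partial>?B)\<^sup>2"
    using variance_positive[of ?X] variance_eq[OF int int2] by simp
  ultimately have "(\<integral>\<omega>. ?X \<omega> \<partial>?B)\<^sup>2 \<le> 2\<^sup>2 * (h * (p * (1 - p)))" by simp
  then have "(\<integral>\<omega>. ?X \<omega> \<partial>?B) \<le> sqrt (2\<^sup>2 * (h * (p * (1 - p))))" by (rule real_le_rsqrt)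
  then show ?thesis by (simp only: real_sqrt_mult real_sqrt_abs abs_numeral)
qed

text \<open>With \<open>m\<close> touching edges, \<open>1 - exp (- h * m)\<close> is at most
  \<open>2 * h * m / (1 + h * m)\<close>, and one factor \<open>m\<close> is traded for
  \<open>d\<close> times the number of vertices.\<close>

lemma green_prob_over_card_le:
  assumes v: "v \<in> V" and h: "0 < h" and fin: "finite (cluster E \<omega> v)"
  shows "green_prob E h (cluster E \<omega> v) / real (card (cluster E \<omega> v))
    \<le> real d * (2 * h / (1 + h * real (card (edge_boundary E (cluster E \<omega> v)))))"
proof -
  let ?K = "cluster E \<omega> v"
  define m where "m = real (card (edge_boundary E ?K))"
  have m: "0 \<le> m" by (simp add: m_def)
  have "card (edge_boundary E ?K) \<le> d * card ?K"
    by (rule card_edge_boundary_le[OF fin cluster_subset[OF v]])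
  then have md: "m \<le> real d * real (card ?K)" unfolding m_def by (simp only: of_nat_mult[symmetric] of_nat_le_iff)
  have K: "0 < real (card ?K)" using fin cluster_refl[of v E \<omega>] by (auto simp: card_gt_0_iff)
  have "green_prob E h ?K = 1 - exp (- (h * m))" by (simp add: green_prob_def m_def)
  also have "\<dots> \<le> 2 * (h * m) / (1 + h * m)" using h m by (intro one_minus_exp_le) simp
  also have "\<dots> = 2 * h / (1 + h * m) * m" by simp
  also have "\<dots> \<le> 2 * h / (1 + h * m) * (real d * real (card ?K))"
    using h m by (intro mult_left_mono[OF md] divide_nonneg_nonneg add_nonneg_nonneg) simp_all
  also have "\<dots> = real d * (2 * h / (1 + h * m)) * real (card ?K)" by simp
  finally show ?thesis unfolding m_def[symmetric] using K by (simp only: pos_divide_le_eq)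
qed

lemma outflow_bounds:
  assumes v: "v \<in> V" and h: "0 < h" and c: "\<And>b. 0 \<le> c b" "\<And>b. c b \<le> 1"
  shows "0 \<le> outflow h c v \<omega>" and "outflow h c v \<omega> \<le> 2 * real d"
proof -
  let ?K = "cluster E \<omega> v"
  let ?F = "edge_boundary E ?K"
  show "0 \<le> outflow h c v \<omega>"
    unfolding outflow_def using c green_prob_nonneg[OF h]
    by (auto intro!: mult_nonneg_nonneg divide_nonneg_nonneg sum_nonneg)
  show "outflow h c v \<omega> \<le> 2 * real d"
  proof (cases "finite ?K")
    case True
    have "(\<Sum>e\<in>?F. c (\<omega> e)) \<le> real (card ?F) * 1" by (rule sum_bounded_above[OF c(2)])
    also have "\<dots> \<le> real d * real (card ?K)"
      using card_edge_boundary_le[OF True cluster_subset[OF v]]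
      by (simp only: of_nat_mult[symmetric] of_nat_le_iff mult_1_right)
    finally have s: "(\<Sum>e\<in>?F. c (\<omega> e)) \<le> real d * real (card ?K)" .
    have K: "0 < real (card ?K)" using True cluster_refl[of v E \<omega>] by (auto simp: card_gt_0_iff)
    have "outflow h c v \<omega> \<le> 1 / real (card ?K) * (2 * (real d * real (card ?K)))"
      unfolding outflow_def if_P[OF True] using s c K green_prob_le_1
      by (intro mult_mono divide_right_mono mult_left_mono sum_nonneg mult_nonneg_nonneg divide_nonneg_nonneg) simp_all
    also have "\<dots> = 2 * real d" using K by simp
    finally show ?thesis .
  qed (simp add: outflow_def)
qed

text \<open>The two outflows share the factor \<open>green_prob\<close> per vertex, so their
  difference is a multiple of the signed fluctuation; the absolute value lets that factor be
  replaced by its upper bound.\<close>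

lemma outflow_diff_le:
  assumes v: "v \<in> V" and h: "0 < h"
  shows "outflow h (\<lambda>_. p) v \<omega> - outflow h of_bool v \<omega> \<le> 2 * real d * deviation p h v \<omega>"
proof (cases "finite (cluster E \<omega> v)")
  case True
  let ?K = "cluster E \<omega> v"
  let ?F = "edge_boundary E ?K"
  let ?a = "green_prob E h ?K / real (card ?K)"
  let ?z = "p * real (card ?F) - (\<Sum>e\<in>?F. of_bool (\<omega> e))"
  let ?r = "2 * h / (1 + h * real (card ?F))"
  have a: "0 \<le> ?a" using green_prob_nonneg[OF h] by (intro divide_nonneg_nonneg) simp_all
  have "outflow h (\<lambda>_. p) v \<omega> - outflow h of_bool v \<omega>
      = ?a * (2 * (\<Sum>e\<in>?F. p)) - ?a * (2 * (\<Sum>e\<in>?F. of_bool (\<omega> e)))"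
    unfolding outflow_def if_P[OF True] ..
  also have "\<dots> = 2 * (?a * ?z)"
    by (simp only: sum_constant right_diff_distrib[symmetric]) (simp only: mult_ac)
  also have "?a * ?z \<le> ?a * \<bar>?z\<bar>" by (rule mult_left_mono[OF abs_ge_self a])
  also have "\<dots> \<le> (real d * ?r) * \<bar>?z\<bar>"
    by (rule mult_right_mono[OF green_prob_over_card_le[OF v h True] abs_ge_zero])
  also have "\<dots> = real d * deviation p h v \<omega>"
    unfolding deviation_def if_P[OF True] by (simp only: mult.assoc)
  finally show ?thesis by simp
qed (simp add: outflow_def deviation_def)

text \<open>Conditioning on \<open>e\<close>, with means \<open>T\<close> (open) and
  \<open>F\<close> (closed):
  \<open>p * (p * T + (1 - p) * F) - p * T = p * (1 - p) * (F - T)\<close>.\<close>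

lemma edge_mass_expectation_gap:
  assumes e: "e \<in> E" and p: "0 \<le> p" "p \<le> 1" and h: "0 < h"
  shows "(\<integral>\<omega>. edge_mass h \<omega> e * p \<partial>bond_percolation E p)
      - (\<integral>\<omega>. edge_mass h \<omega> e * of_bool (\<omega> e) \<partial>bond_percolation E p)
    = p * (1 - p) * (\<integral>\<omega>. mass_drop h \<omega> e \<partial>bond_percolation E p)"
proof -
  let ?B = "bond_percolation E p"
  interpret prob_space ?B by (rule prob_space_bond)
  note b = edge_mass_bounds[OF e h] and m = measurable_edge_mass[OF e h, of p]
  let ?T = "\<integral>\<omega>. edge_mass h (fun_upd \<omega> e True) e \<partial>?B"
  let ?F = "\<integral>\<omega>. edge_mass h (fun_upd \<omega> e False) e \<partial>?B"
  have int: "integrable ?B (\<lambda>\<omega>. edge_mass h (fun_upd \<omega> e x) e)" for x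
    by (rule integrable_const_bound[of _ 2])
      (use b measurable_compose[OF measurable_bond_update_const[OF e] m] in auto)
  have "(\<integral>\<omega>. edge_mass h \<omega> e \<partial>?B) = p * ?T + (1 - p) * ?F"
    by (rule integral_resample[OF e p m b])
  moreover have "(\<integral>\<omega>. edge_mass h \<omega> e * of_bool (\<omega> e) \<partial>?B)
      = p * (\<integral>\<omega>. edge_mass h (fun_upd \<omega> e True) e * of_bool (fun_upd \<omega> e True e) \<partial>?B)
        + (1 - p) * (\<integral>\<omega>. edge_mass h (fun_upd \<omega> e False) e * of_bool (fun_upd \<omega> e False e) \<partial>?B)"
  proof (rule integral_resample[OF e p, where C = 2])
    show "(\<lambda>\<omega>. edge_mass h \<omega> e * of_bool (\<omega> e)) \<in> borel_measurable ?B"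
      by (rule borel_measurable_times[OF m measurable_edge_weight[OF e]])
    show "0 \<le> edge_mass h \<omega> e * of_bool (\<omega> e)" for \<omega> using b by simp
    show "edge_mass h \<omega> e * of_bool (\<omega> e) \<le> 2" for \<omega> using b[of \<omega>] by (cases "\<omega> e") simp_all
  qed
  then have "(\<integral>\<omega>. edge_mass h \<omega> e * of_bool (\<omega> e) \<partial>?B) = p * ?T" by simp
  moreover have "(\<integral>\<omega>. mass_drop h \<omega> e \<partial>?B) = ?F - ?T"
    unfolding mass_drop_def by (rule Bochner_Integration.integral_diff[OF int int])
  moreover have "(\<integral>\<omega>. edge_mass h \<omega> e * p \<partial>?B) = (\<integral>\<omega>. edge_mass h \<omega> e \<partial>?B) * p" by simp
  moreover have "(p * ?T + (1 - p) * ?F) * p - p * ?T = p * (1 - p) * (?F - ?T)"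
    by (simp add: algebra_simps)
  ultimately show ?thesis by (simp only:)
qed

section \<open>Assembly of the bound\<close>

text \<open>All drops are nonnegative, so the term of \<open>e\<close> is at most the sum over the
  edges at one endpoint, to which mass transport applies.\<close>

lemma expected_mass_drop_le:
  assumes e: "e \<in> E" and p: "0 < p" "p \<le> 1" and h: "0 < h"
  shows "p * (1 - p) * (\<integral>\<omega>. mass_drop h \<omega> e \<partial>bond_percolation E p)
    \<le> 4 * real d * sqrt (h * (p * (1 - p)))"
proof -
  let ?B = "bond_percolation E p"
  interpret prob_space ?B by (rule prob_space_bond)
  have p': "0 \<le> p" using p by simp
  obtain v y where v: "v \<in> V" "e = {v, y}" using edgeE[OF e] by metis
  let ?N = "{f \<in> E. v \<in> f}"
  \<comment> \<open>The transport identity is moved to the reals so that its instances for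
    \<open>p\<close> and \<open>of_bool\<close> can be subtracted.\<close>
  have real_transport: "(\<Sum>f\<in>?N. \<integral>\<omega>. edge_mass h \<omega> f * c (\<omega> f) \<partial>?B) = (\<integral>\<omega>. outflow h c v \<omega> \<partial>?B)"
    and out_int: "integrable ?B (outflow h c v)"
    if c: "\<And>b. 0 \<le> c b" "\<And>b. c b \<le> 1" for c :: "bool \<Rightarrow> real"
  proof -
    have nonneg: "0 \<le> edge_mass h \<omega> f * c (\<omega> f)" if "f \<in> ?N" for \<omega> f
      using that c edge_mass_bounds[of f h \<omega>] h by simp
    have int: "integrable ?B (\<lambda>\<omega>. edge_mass h \<omega> f * c (\<omega> f))" if f: "f \<in> ?N" for f
    proof (rule integrable_const_bound[of _ 2], rule AE_I2)
      have f': "f \<in> E" using f by simp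
      show "(\<lambda>\<omega>. edge_mass h \<omega> f * c (\<omega> f)) \<in> borel_measurable ?B"
        by (rule borel_measurable_times[OF measurable_edge_mass[OF f' h] measurable_edge_weight[OF f']])
      fix \<omega>
      have "edge_mass h \<omega> f * c (\<omega> f) \<le> 2 * 1"
        using edge_mass_bounds[OF f' h, of \<omega>] c by (intro mult_mono) simp_all
      then show "norm (edge_mass h \<omega> f * c (\<omega> f)) \<le> 2" using nonneg[OF f, of \<omega>] by simp
    qed
    show out: "integrable ?B (outflow h c v)"
      by (rule integrable_const_bound[of _ "2 * real d"])
        (use outflow_bounds[OF v(1) h c] measurable_outflow[OF v(1)] in auto)
    have pos: "0 \<le> (\<integral>\<omega>. edge_mass h \<omega> f * c (\<omega> f) \<partial>?B)" if "f \<in> ?N" for f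
      by (rule integral_nonneg_AE[OF AE_I2[OF nonneg[OF that]]])
    have "ennreal (\<Sum>f\<in>?N. \<integral>\<omega>. edge_mass h \<omega> f * c (\<omega> f) \<partial>?B)
        = (\<Sum>f\<in>?N. ennreal (\<integral>\<omega>. edge_mass h \<omega> f * c (\<omega> f) \<partial>?B))"
      by (rule sum_ennreal[symmetric, OF pos])
    also have "\<dots> = (\<Sum>f\<in>?N. \<integral>\<^sup>+\<omega>. ennreal (edge_mass h \<omega> f * c (\<omega> f)) \<partial>?B)"
      by (rule sum.cong[OF refl], rule nn_integral_eq_integral[symmetric, OF int AE_I2[OF nonneg]])
    also have "\<dots> = (\<integral>\<^sup>+\<omega>. ennreal (outflow h c v \<omega>) \<partial>?B)"
      by (rule transport_identity[OF v(1) c(1) h])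
    also have "\<dots> = ennreal (\<integral>\<omega>. outflow h c v \<omega> \<partial>?B)"
      by (rule nn_integral_eq_integral[OF out AE_I2[OF outflow_bounds(1)[OF v(1) h c]]])
    finally show "(\<Sum>f\<in>?N. \<integral>\<omega>. edge_mass h \<omega> f * c (\<omega> f) \<partial>?B) = (\<integral>\<omega>. outflow h c v \<omega> \<partial>?B)"
      by (subst (asm) ennreal_inj)
        (rule sum_nonneg[OF pos] integral_nonneg_AE[OF AE_I2[OF outflow_bounds(1)[OF v(1) h c]]], assumption?)+
  qed
  have drop_pos: "0 \<le> p * (1 - p) * (\<integral>\<omega>. mass_drop h \<omega> f \<partial>?B)" if "f \<in> E" for f
    using p by (intro mult_nonneg_nonneg integral_nonneg_AE AE_I2 mass_drop_nonneg[OF that h]) simp_all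
  have "p * (1 - p) * (\<integral>\<omega>. mass_drop h \<omega> e \<partial>?B)
      \<le> (\<Sum>f\<in>?N. p * (1 - p) * (\<integral>\<omega>. mass_drop h \<omega> f \<partial>?B))"
    by (rule member_le_sum[of e ?N "\<lambda>f. p * (1 - p) * (\<integral>\<omega>. mass_drop h \<omega> f \<partial>?B)"])
      (use e v drop_pos finite_edges_at[OF v(1)] in auto)
  also have "\<dots> = (\<Sum>f\<in>?N. (\<integral>\<omega>. edge_mass h \<omega> f * p \<partial>?B)
      - (\<integral>\<omega>. edge_mass h \<omega> f * of_bool (\<omega> f) \<partial>?B))"
    by (rule sum.cong[OF refl], rule edge_mass_expectation_gap[symmetric, OF _ p' p(2) h]) simp
  also have "\<dots> = (\<integral>\<omega>. outflow h (\<lambda>_. p) v \<omega> \<partial>?B) - (\<integral>\<omega>. outflow h of_bool v \<omega> \<partial>?B)"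
    using real_transport[of "\<lambda>_. p"] real_transport[of of_bool] p by (simp add: sum_subtractf)
  also have "\<dots> = (\<integral>\<omega>. outflow h (\<lambda>_. p) v \<omega> - outflow h of_bool v \<omega> \<partial>?B)"
    using p by (intro Bochner_Integration.integral_diff[symmetric] out_int) simp_all
  also have "\<dots> \<le> (\<integral>\<omega>. 2 * real d * deviation p h v \<omega> \<partial>?B)"
  proof (rule integral_mono)
    show "integrable ?B (\<lambda>\<omega>. outflow h (\<lambda>_. p) v \<omega> - outflow h of_bool v \<omega>)"
      using p by (intro Bochner_Integration.integrable_diff out_int) simp_all
    have "integrable ?B (deviation p h v)"
      by (rule integrable_const_bound[of _ 2])
        (use deviation_bounds[OF v(1) p' p(2) h] measurable_deviation[OF v(1)] in auto)
    then show "integrable ?B (\<lambda>\<omega>. 2 * real d * deviation p h v \<omega>)" by simp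
  qed (rule outflow_diff_le[OF v(1) h])
  also have "\<dots> = 2 * real d * (\<integral>\<omega>. deviation p h v \<omega> \<partial>?B)" by simp
  also have "\<dots> \<le> 2 * real d * (2 * sqrt (h * (p * (1 - p))))"
    by (rule mult_left_mono[OF expectation_deviation_le[OF v(1) p' p(2) h]]) simp
  finally show ?thesis by simp
qed

text \<open>Fubini over the ghost field leaves the mass drop on the event that \<open>e\<close> is
  closed. The drop ignores the state of \<open>e\<close>, so resampling \<open>e\<close> contributes
  the factor \<open>1 - p\<close>.\<close>

lemma prob_two_ghost_event_le:
  assumes e: "e \<in> E" and p: "0 \<le> p" "p \<le> 1" and h: "0 < h"
  shows "measure (ghost_percolation E p h) (two_ghost_event E p h e)
    \<le> (1 - p) * (\<integral>\<omega>. mass_drop h \<omega> e \<partial>bond_percolation E p)"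
proof -
  let ?B = "bond_percolation E p" and ?G = "bond_percolation E (1 - exp (- h))"
  let ?T = "two_ghost_event E p h e"
  let ?X = "\<lambda>\<omega>. if \<omega> e then 0 else mass_drop h \<omega> e"
  interpret B: prob_space ?B by (rule prob_space_bond)
  interpret G: prob_space ?G by (rule prob_space_bond)
  have P: "ghost_percolation E p h = ?B \<Otimes>\<^sub>M ?G"
    by (simp add: ghost_percolation_def bond_percolation_def)
  have nonneg: "0 \<le> mass_drop h \<omega> e" for \<omega> by (rule mass_drop_nonneg[OF e h])
  have le2: "mass_drop h \<omega> e \<le> 2" for \<omega>
    using edge_mass_bounds[OF e h, of "fun_upd \<omega> e False"] edge_mass_bounds[OF e h, of "fun_upd \<omega> e True"]
    by (simp add: mass_drop_def)
  have meas: "(\<lambda>\<omega>. mass_drop h \<omega> e) \<in> borel_measurable ?B"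
    unfolding mass_drop_def
    by (intro borel_measurable_diff measurable_compose[OF measurable_bond_update_const[OF e] measurable_edge_mass[OF e h]])
  have measX: "?X \<in> borel_measurable ?B"
    by (rule measurable_If[OF measurable_const meas predE[OF measurable_bond_component[OF e]]]) simp
  have posX: "0 \<le> ?X \<omega>" "?X \<omega> \<le> 2" for \<omega> using nonneg le2 by simp_all
  have "(\<integral>\<omega>. ?X \<omega> \<partial>?B) = p * (\<integral>\<omega>. ?X (fun_upd \<omega> e True) \<partial>?B)
      + (1 - p) * (\<integral>\<omega>. ?X (fun_upd \<omega> e False) \<partial>?B)"
    by (rule integral_resample[OF e p measX posX])
  also have "\<dots> = (1 - p) * (\<integral>\<omega>. mass_drop h \<omega> e \<partial>?B)"
    by (simp add: mass_drop_def)
  finally have X: "(\<integral>\<omega>. ?X \<omega> \<partial>?B) = (1 - p) * (\<integral>\<omega>. mass_drop h \<omega> e \<partial>?B)" .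
  have intX: "integrable ?B ?X"
    by (rule B.integrable_const_bound[of _ 2]) (use posX measX in auto)
  have pos: "0 \<le> (\<integral>\<omega>. ?X \<omega> \<partial>?B)" by (rule integral_nonneg_AE[OF AE_I2[OF posX(1)]])
  show ?thesis
  proof (cases "?T \<in> sets (?B \<Otimes>\<^sub>M ?G)")
    case True
    have "emeasure (?B \<Otimes>\<^sub>M ?G) ?T = (\<integral>\<^sup>+\<omega>. emeasure ?G (Pair \<omega> -` ?T) \<partial>?B)"
      by (rule G.emeasure_pair_measure_alt[OF True])
    also have "\<dots> \<le> (\<integral>\<^sup>+\<omega>. ennreal (?X \<omega>) \<partial>?B)"
      unfolding G.emeasure_eq_measure
      by (intro nn_integral_mono ennreal_leI section_two_ghost_event_bound[OF e h])
    also have "\<dots> = ennreal (\<integral>\<omega>. ?X \<omega> \<partial>?B)"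
      by (rule nn_integral_eq_integral[OF intX AE_I2[OF posX(1)]])
    finally have "measure (?B \<Otimes>\<^sub>M ?G) ?T \<le> (\<integral>\<omega>. ?X \<omega> \<partial>?B)"
      unfolding measure_def using pos by (rule enn2real_leI[rotated])
    then show ?thesis unfolding P X .
  next
    \<comment> \<open>A set outside the sigma-algebra has \<open>measure\<close> 0 by convention, so
      the bound holds without deciding measurability of the event.\<close>
    case False
    then show ?thesis unfolding P X[symmetric] using pos by (simp add: measure_notin_sets)
  qed
qed

end

theorem theorem1p6:
  fixes V :: "'v set" and E :: "'v set set" and d :: nat
    and e :: "'v set" and p h :: real
  assumes "is_graph V E"
    and "connected_graph V E"
    and "locally_finite_graph V E"
    and "transitive_graph V E"
    and "unimodular_graph V E"
    and "\<forall>v\<in>V. vertex_degree E v = d"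
    and "e \<in> E"
    and "0 < p" and "p \<le> 1"
    and "0 < h"
  shows "measure (ghost_percolation E p h) (two_ghost_event E p h e)
           \<le> 33 * real d * sqrt ((1 - p) / p * h)"
proof -
  interpret lf_transitive_graph V E d
    using assms by unfold_locales simp_all
  let ?P = "measure (ghost_percolation E p h) (two_ghost_event E p h e)"
  have "p * ?P \<le> p * ((1 - p) * (\<integral>\<omega>. mass_drop h \<omega> e \<partial>bond_percolation E p))"
    using assms(7-10) by (intro mult_left_mono prob_two_ghost_event_le) simp_all
  also have "\<dots> \<le> 4 * real d * sqrt (h * (p * (1 - p)))"
    unfolding mult.assoc[symmetric, of p] using assms(7-10) by (intro expected_mass_drop_le)
  \<comment> \<open>A factor \<open>p\<close> is extracted from the square root to cancel the one on
    the left.\<close>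
  also have "h * (p * (1 - p)) = p\<^sup>2 * ((1 - p) / p * h)"
    using assms(8) by (simp add: power2_eq_square)
  also have "4 * real d * sqrt (p\<^sup>2 * ((1 - p) / p * h)) = p * (4 * real d * sqrt ((1 - p) / p * h))"
    using assms(8) by (simp only: real_sqrt_mult real_sqrt_abs abs_of_pos mult_ac)
  finally have "?P \<le> 4 * real d * sqrt ((1 - p) / p * h)"
    using assms(8) by (simp only: mult_le_cancel_left_pos)
  \<comment> \<open>The argument gives the constant 4, and 33 is slack.\<close>
  also have "\<dots> \<le> 33 * real d * sqrt ((1 - p) / p * h)"
    using assms(8-10) by (intro mult_right_mono) simp_all
  finally show ?thesis .
qed

end
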